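(* Let any integer $k \geq 1$ and any dimension $d\geq 1$ be given, and let $t,\alpha,\beta \geq 1$ be integers. There exists $f:\mathbb{R}^d \to \mathbb{R}$ computed by a neural network with standard ReLU gates in $2k^3+8$ layers, $3k^3 + 12$ total nodes, and $4+d$ distinct parameters so that \[ \inf_{g \in \mathcal{C}} \int_{[0,1]^d} |f(x)-g(x)|\,dx \geq \frac{1}{64}, \] where $\mathcal{C}$ is the union of the following two sets of functions: (i) functions computed by networks of $(t,\alpha,\beta)$-semi-algebraic gates in $\leq k$ layers and $\leq 2^{k}/(t\alpha\beta)$ nodes; (ii) functions computed by linear combinations of $\leq t$ decision trees each with $\leq 2^{k^3}/t$ nodes.
   Context: A neural network is given by a directed acyclic graph: layer 0 consists of the $d$ input coordinate maps $x\mapsto x_i$; each internal node applies a gate function to the outputs of its parent nodes (and to a shared parameter vector, parameters possibly reused across nodes); the unique node with no outgoing edges gives the output. A standard ReLU gate computes $v\mapsto \max\{0, \langle a, v\rangle + b\}$ for parameters $a,b$. A function $\phi:\mathbb{R}^k\to\mathbb{R}$ is $(t,\alpha,\beta)$-semi-algebraic if there exist $t$ polynomials $(q_i)_{i=1}^t$ of degree $\leq\alpha$ and finitely many triples $(U_j,L_j,p_j)_{j=1}^m$ with $U_j,L_j\subseteq\{1,\ldots,t\}$ and $p_j$ a polynomial of degree $\leq\beta$ such that $\phi(v)=\sum_{j=1}^m p_j(v)\prod_{i\in L_j}\mathbf{1}[q_i(v)<0]\prod_{i\in U_j}\mathbf{1}[q_i(v)\geq 0]$ (this includes standard ReLU gates,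 max/min gates of polynomials, and piecewise polynomial activations composed with polynomials). A decision tree with $k$ nodes is, for $k=1$, a constant function, and for $k>1$, evaluates $x\mapsto \mathbf{1}[\langle a,x\rangle - b\geq 0]$ and then conditionally evaluates a left decision tree with $l$ nodes or a right decision tree with $r$ nodes, where $l+r<k$. *)

theory Defs
  imports "HOL-Analysis.Analysis"
begin

definition poly_fn :: "nat \<Rightarrow> nat \<Rightarrow> (real list \<Rightarrow> real) \<Rightarrow> bool" where
  "poly_fn m a p \<longleftrightarrow> (\<exists>c :: nat list \<Rightarrow> real. \<forall>v. length v = m \<longrightarrow>
     p v = (\<Sum>e\<in>{e. length e = m \<and> sum_list e \<le> a}. c e * (\<Prod>i<m. (v ! i) ^ (e ! i))))"

definition semialg :: "nat \<Rightarrow> nat \<Rightarrow> nat \<Rightarrow> nat \<Rightarrow> (real list \<Rightarrow> real) \<Rightarrow> bool" where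
  "semialg m t \<alpha> \<beta> \<phi> \<longleftrightarrow>
     (\<exists>(q :: nat \<Rightarrow> real list \<Rightarrow> real) (M :: nat) (U :: nat \<Rightarrow> nat set) (L :: nat \<Rightarrow> nat set)
        (p :: nat \<Rightarrow> real list \<Rightarrow> real).
        (\<forall>i<t. poly_fn m \<alpha> (q i)) \<and>
        (\<forall>j<M. U j \<subseteq> {0..<t} \<and> L j \<subseteq> {0..<t} \<and> poly_fn m \<beta> (p j)) \<and>
        (\<forall>v. length v = m \<longrightarrow>
           \<phi> v = (\<Sum>j<M. p j v * (\<Prod>i\<in>L j. if q i v < 0 then 1 else 0)
                                 * (\<Prod>i\<in>U j. if q i v \<ge> 0 then 1 else 0))))"

text \<open>A network on inputs indexed by the finite type 'd has N internal nodes 0..N-1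
  (in topological order). Parents of a node are input coordinates (Inl j) or
  earlier internal nodes (Inr i). The gate of node i maps the list of its parents'
  values to a real. The output is the last internal node N-1.\<close>

fun net_vals :: "(nat \<Rightarrow> ('d::finite + nat) list) \<Rightarrow> (nat \<Rightarrow> real list \<Rightarrow> real) \<Rightarrow> real^'d \<Rightarrow> nat \<Rightarrow> real list" where
  "net_vals par gate x 0 = []"
| "net_vals par gate x (Suc i) =
     (let vs = net_vals par gate x i in
      vs @ [gate i (map (\<lambda>u. case u of Inl j \<Rightarrow> x $ j | Inr i' \<Rightarrow> vs ! i') (par i))])"

definition net_eval :: "nat \<Rightarrow> (nat \<Rightarrow> ('d + nat) list) \<Rightarrow> (nat \<Rightarrow> real list \<Rightarrow> real) \<Rightarrow> real^'d \<Rightarrow> real" where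
  "net_eval N par gate x = net_vals par gate x N ! (N - 1)"

fun net_depths :: "(nat \<Rightarrow> ('d + nat) list) \<Rightarrow> nat \<Rightarrow> nat list" where
  "net_depths par 0 = []"
| "net_depths par (Suc i) =
     (let ds = net_depths par i in
      ds @ [Suc (Max (set (0 # map (\<lambda>u. case u of Inl j \<Rightarrow> 0 | Inr i' \<Rightarrow> ds ! i') (par i))))])"

definition net_layers :: "nat \<Rightarrow> (nat \<Rightarrow> ('d + nat) list) \<Rightarrow> nat" where
  "net_layers N par = net_depths par N ! (N - 1)"

text \<open>Well-formed DAG: at least one internal node, parents precede children, and the
  last node is the unique node without outgoing edges.\<close>
definition wf_net :: "nat \<Rightarrow> (nat \<Rightarrow> ('d::finite + nat) list) \<Rightarrow> bool" where
  "wf_net N par \<longleftrightarrow> N \<ge> 1 \<and>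
     (\<forall>i<N. \<forall>u\<in>set (par i). case u of Inl j \<Rightarrow> True | Inr i' \<Rightarrow> i' < i) \<and>
     (\<forall>j::'d. \<exists>i<N. Inl j \<in> set (par i)) \<and>
     (\<forall>i'<N - 1. \<exists>i<N. Inr i' \<in> set (par i))"

text \<open>f is computed by a network of standard ReLU gates with at most L layers, at most
  n internal nodes and at most P distinct parameters: all weights a and biases b are
  entries of a shared parameter vector w indexed by 0..P-1.\<close>
definition relu_net_fn :: "nat \<Rightarrow> nat \<Rightarrow> nat \<Rightarrow> (real^'d::finite \<Rightarrow> real) \<Rightarrow> bool" where
  "relu_net_fn L n P f \<longleftrightarrow>
     (\<exists>N par (w :: nat \<Rightarrow> real) (ai :: nat \<Rightarrow> nat \<Rightarrow> nat) (bi :: nat \<Rightarrow> nat).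
        wf_net N par \<and> N \<le> n \<and> net_layers N par \<le> L \<and>
        (\<forall>i<N. bi i < P \<and> (\<forall>j<length (par i). ai i j < P)) \<and>
        f = net_eval N par
              (\<lambda>i v. max 0 ((\<Sum>j<length (par i). w (ai i j) * v ! j) + w (bi i))))"

definition semialg_net_fns :: "nat \<Rightarrow> real \<Rightarrow> nat \<Rightarrow> nat \<Rightarrow> nat \<Rightarrow> (real^'d::finite \<Rightarrow> real) set" where
  "semialg_net_fns L n t \<alpha> \<beta> = {g. \<exists>N par gate.
      wf_net N par \<and> real N \<le> n \<and> net_layers N par \<le> L \<and>
      (\<forall>i<N. semialg (length (par i)) t \<alpha> \<beta> (gate i)) \<and>
      g = net_eval N par gate}"

datatype ('d::finite) dtree = DLeaf real | DNode "real^'d" real "'d dtree" "'d dtree"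

fun dt_eval :: "('d::finite) dtree \<Rightarrow> real^'d \<Rightarrow> real" where
  "dt_eval (DLeaf c) x = c"
| "dt_eval (DNode a b l r) x = (if a \<bullet> x - b \<ge> 0 then dt_eval l x else dt_eval r x)"

fun dt_nodes :: "('d::finite) dtree \<Rightarrow> nat" where
  "dt_nodes (DLeaf c) = 1"
| "dt_nodes (DNode a b l r) = 1 + dt_nodes l + dt_nodes r"

definition dtree_comb_fns :: "nat \<Rightarrow> real \<Rightarrow> (real^'d::finite \<Rightarrow> real) set" where
  "dtree_comb_fns t n = {g. \<exists>m (c :: nat \<Rightarrow> real) (T :: nat \<Rightarrow> 'd dtree).
      m \<le> t \<and> (\<forall>i<m. real (dt_nodes (T i)) \<le> n) \<and>
      g = (\<lambda>x. \<Sum>i<m. c i * dt_eval (T i) x)}"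

end

theory Submission
  imports Defs "HOL-Computational_Algebra.Polynomial"
begin

text \<open>
  The hard function is the \<open>n\<close>-fold iterate of the tent map applied to one coordinate, with
  \<open>n = k\<^sup>3 + 4\<close>: each tent costs three ReLU nodes and two layers, and the iterate oscillates
  \<open>2\<^sup>n\<^sup>-\<^sup>1\<close> times. Along a line, a function of the competing class is piecewise polynomial with a set
  of breakpoints that each layer enlarges at most by the factor \<open>1 + N t \<alpha> \<beta>\<^sup>i\<close>, so it crosses the
  level \<open>1/2\<close> at most \<open>2 ^ (k\<^sup>3 + 2)\<close> times; a decision tree has at most one breakpoint per node.
  Where the iterate is near 1 at some point and near 0 one half-period further, while the
  competitor stays on one side of \<open>1/2\<close>, the two differ by at least \<open>1/4\<close> at one of the two points.
  Cutting the cube into translates of a single slab and summing over the translates turns this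
  count of half-periods into the \<open>L\<^sup>1\<close> bound by translation invariance alone, without Fubini.
\<close>

section \<open>Piecewise polynomials and their breakpoints\<close>

text \<open>Cells are the components of the complement of the finite set \<open>Z\<close>, numbered from the left;
  the values on \<open>Z\<close> itself are left unconstrained.\<close>

definition cell :: "real set \<Rightarrow> real \<Rightarrow> nat" where
  "cell Z x = card {z \<in> Z. z < x}"

definition piecewise_poly :: "nat \<Rightarrow> real set \<Rightarrow> (real \<Rightarrow> real) \<Rightarrow> bool" where
  "piecewise_poly D Z \<phi> \<longleftrightarrow>
     (\<forall>j. \<exists>p. degree p \<le> D \<and> (\<forall>x. x \<notin> Z \<longrightarrow> cell Z x = j \<longrightarrow> \<phi> x = poly p x))"

lemma cell_le_card: "finite Z \<Longrightarrow> cell Z x \<le> card Z"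
  unfolding cell_def by (rule card_mono) auto

lemma cell_eq_if_no_breakpoint:
  assumes "x \<le> y" "{x..y} \<inter> Z = {}"
  shows "cell Z x = cell Z y"
proof -
  have "{z \<in> Z. z < x} = {z \<in> Z. z < y}"
    using assms by (auto simp: disjoint_iff not_less)
  then show ?thesis unfolding cell_def by simp
qed

lemma no_breakpoint_if_cell_eq:
  assumes "finite Z" "y \<notin> Z" "cell Z x = cell Z y" "x \<le> y"
  shows "{x..y} \<inter> Z = {}"
proof -
  have "{z \<in> Z. z < x} = {z \<in> Z. z < y}"
    using assms unfolding cell_def by (intro card_subset_eq) auto
  then have "z < x" if "z \<in> Z" "z \<le> y" for z
    using that \<open>y \<notin> Z\<close> by (metis (mono_tags, lifting) less_le mem_Collect_eq)
  then show ?thesis by (meson atLeastAtMost_iff disjoint_iff not_less)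
qed

text \<open>Breakpoint sets only grow from layer to layer, and this lets data attached to the cells
  of the coarser \<open>Z\<close> be read off on the cells of the finer \<open>Z'\<close>: an
  interval free of \<open>Z'\<close> is free of \<open>Z\<close>.\<close>

lemma cell_eq_subset:
  assumes "finite Z'" "Z \<subseteq> Z'" "x \<notin> Z'" "y \<notin> Z'" "cell Z' x = cell Z' y"
  shows "cell Z x = cell Z y"
  using assms
proof (induction x y rule: linorder_wlog)
  case (le x y)
  then have "{x..y} \<inter> Z' = {}" by (intro no_breakpoint_if_cell_eq) auto
  then show ?case using le by (intro cell_eq_if_no_breakpoint) auto
next
  case (sym x y)
  then show ?case by metis
qed

lemma poly_sign_eq_if_no_root:
  fixes q :: "real poly"
  assumes "x \<le> y" "\<And>z. x \<le> z \<Longrightarrow> z \<le> y \<Longrightarrow> poly q z \<noteq> 0"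
  shows "poly q x < 0 \<longleftrightarrow> poly q y < 0"
proof (cases "x = y")
  case False
  with assms have "x < y" by simp
  then show ?thesis
    using poly_IVT_pos[of x y q] poly_IVT_neg[of x y q] assms(2)[of x] assms(2)[of y] assms(2)
    by (smt (verit))
qed simp

text \<open>By the intermediate value theorem a change of sign forces a root between the two points,
  and a cell contains none. The root condition is restricted to \<open>q \<noteq> 0\<close> because
  the zero polynomial vanishes everywhere while its sign is constant.\<close>

lemma poly_sign_eq_if_cell_eq:
  assumes "finite Z" "x \<notin> Z" "y \<notin> Z" "cell Z x = cell Z y"
    and "q \<noteq> 0 \<Longrightarrow> {z. poly q z = 0} \<subseteq> Z"
  shows "poly q x < 0 \<longleftrightarrow> poly q y < 0"
  using assms
proof (induction x y rule: linorder_wlog)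
  case (le x y)
  then have *: "{x..y} \<inter> Z = {}" by (intro no_breakpoint_if_cell_eq) auto
  show ?case
  proof (cases "q = 0")
    case False
    then show ?thesis using le * by (intro poly_sign_eq_if_no_root) auto
  qed simp
next
  case (sym x y)
  then show ?case by metis
qed

section \<open>Effect of a single gate on piecewise polynomial inputs\<close>

lemma finite_exponents: "finite {e :: nat list. length e = m \<and> sum_list e \<le> a}"
proof (rule finite_subset)
  show "{e. length e = m \<and> sum_list e \<le> a} \<subseteq> {e. set e \<subseteq> {..a} \<and> length e = m}"
    by (auto intro: order_trans[OF member_le_sum_list])
  show "finite {e. set e \<subseteq> {..a} \<and> length e = m}"
    by (rule finite_lists_length_eq) simp
qed

text \<open>Substituting univariate polynomials of degree \<open>D\<close> into a monomial of total
  degree at most \<open>a\<close> gives degree at most \<open>a * D\<close>. The polynomial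
  \<open>Q\<close> depends only on \<open>P\<close>, so it serves a whole cell at once.\<close>

lemma poly_fn_compose:
  assumes "poly_fn m a p" "\<And>i. i < m \<Longrightarrow> degree (P i) \<le> D"
  shows "\<exists>Q. degree Q \<le> a * D \<and>
           (\<forall>x v. length v = m \<longrightarrow> (\<forall>i<m. v ! i = poly (P i) x) \<longrightarrow> p v = poly Q x)"
proof -
  let ?E = "{e :: nat list. length e = m \<and> sum_list e \<le> a}"
  obtain c where c: "\<And>v. length v = m \<Longrightarrow>
     p v = (\<Sum>e\<in>?E. c e * (\<Prod>i<m. (v ! i) ^ (e ! i)))"
    using assms(1) unfolding poly_fn_def by blast
  define Q where "Q = (\<Sum>e\<in>?E. smult (c e) (\<Prod>i<m. P i ^ (e ! i)))"
  have "degree Q \<le> a * D" unfolding Q_def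
  proof (intro degree_sum_le finite_exponents)
    fix e assume e: "e \<in> ?E"
    have "degree (\<Prod>i<m. P i ^ (e ! i)) \<le> (\<Sum>i<m. degree (P i ^ (e ! i)))"
      using degree_prod_sum_le[of "{..<m}" "\<lambda>i. P i ^ (e ! i)"] by (simp add: o_def)
    also have "\<dots> \<le> (\<Sum>i<m. D * (e ! i))"
      using assms(2) by (intro sum_mono order_trans[OF degree_power_le]) auto
    also have "\<dots> = D * sum_list e"
      using e by (simp add: sum_list_sum_nth sum_distrib_left atLeast0LessThan)
    also have "\<dots> \<le> a * D" using e by (simp add: mult.commute)
    finally show "degree (smult (c e) (\<Prod>i<m. P i ^ (e ! i))) \<le> a * D"
      using degree_smult_le le_trans by blast
  qed
  moreover have "p v = poly Q x" if "length v = m" "\<forall>i<m. v ! i = poly (P i) x" for x v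
    using that c[OF that(1)] by (simp add: Q_def poly_sum poly_prod)
  ultimately show ?thesis by blast
qed

lemma prod_indicator_cong:
  assumes "\<And>i. i \<in> A \<Longrightarrow> B i \<longleftrightarrow> B' i"
  shows "(\<Prod>i\<in>A. if B i then 1 else 0 :: real) = (\<Prod>i\<in>A. if B' i then 1 else 0)"
  using assms by (intro prod.cong) auto

text \<open>On each of the \<open>card Z + 1\<close> cells the inputs are polynomials of degree
  \<open>D\<close>, so each of the \<open>t\<close> sign conditions becomes a polynomial with at
  most \<open>\<alpha> * D\<close> roots. Away from these roots \<open>R\<close> all indicators are
  constant on cells and the gate is a polynomial of degree \<open>\<beta> * D\<close>. The
  conclusion covers every finite \<open>Z'\<close> above \<open>Z \<union> R\<close>, so that all
  gates of a layer can later share one breakpoint set.\<close>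

lemma semialg_breakpoints:
  assumes Z: "finite Z" and \<Phi>: "\<And>\<psi>. \<psi> \<in> set \<Phi> \<Longrightarrow> piecewise_poly D Z \<psi>"
    and \<gamma>: "semialg (length \<Phi>) t \<alpha> \<beta> \<gamma>"
  shows "\<exists>R. finite R \<and> card R \<le> (card Z + 1) * (t * (\<alpha> * D)) \<and>
           (\<forall>Z'. finite Z' \<longrightarrow> Z \<union> R \<subseteq> Z' \<longrightarrow>
              piecewise_poly (\<beta> * D) Z' (\<lambda>x. \<gamma> (map (\<lambda>\<psi>. \<psi> x) \<Phi>)))"
proof -
  let ?m = "length \<Phi>"
  let ?v = "\<lambda>x. map (\<lambda>\<psi>. \<psi> x) \<Phi>"
  obtain q and M :: nat and U L p where qp: "\<forall>i<t. poly_fn ?m \<alpha> (q i)"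
    "\<forall>j<M. U j \<subseteq> {0..<t} \<and> L j \<subseteq> {0..<t} \<and> poly_fn ?m \<beta> (p j)"
    and \<gamma>_eq: "\<forall>v. length v = ?m \<longrightarrow>
           \<gamma> v = (\<Sum>j<M. p j v * (\<Prod>i\<in>L j. if q i v < 0 then 1 else 0)
                                 * (\<Prod>i\<in>U j. if q i v \<ge> 0 then 1 else 0))"
    using \<gamma> unfolding semialg_def by blast
  then have q: "\<And>i. i < t \<Longrightarrow> poly_fn ?m \<alpha> (q i)"
    and UL: "\<And>j. j < M \<Longrightarrow> U j \<subseteq> {0..<t} \<and> L j \<subseteq> {0..<t}"
    and p: "\<And>j. j < M \<Longrightarrow> poly_fn ?m \<beta> (p j)"
    by auto
  have "\<forall>l j. \<exists>P. l < ?m \<longrightarrow> degree P \<le> D \<and>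
       (\<forall>x. x \<notin> Z \<longrightarrow> cell Z x = j \<longrightarrow> (\<Phi> ! l) x = poly P x)"
    using \<Phi> unfolding piecewise_poly_def by (metis nth_mem)
  then obtain P where P: "\<And>l j. l < ?m \<Longrightarrow> degree (P l j) \<le> D"
    "\<And>l x. l < ?m \<Longrightarrow> x \<notin> Z \<Longrightarrow> (\<Phi> ! l) x = poly (P l (cell Z x)) x"
    by metis
  have restrict: "\<exists>Q. degree Q \<le> a * D \<and> (\<forall>x. x \<notin> Z \<longrightarrow> cell Z x = j \<longrightarrow> r (?v x) = poly Q x)"
    if r: "poly_fn ?m a r" for a r j
  proof -
    obtain Q where Q: "degree Q \<le> a * D"
      "\<And>x v. length v = ?m \<Longrightarrow> (\<forall>i<?m. v ! i = poly (P i j) x) \<Longrightarrow> r v = poly Q x"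
      using poly_fn_compose[OF r, of "\<lambda>l. P l j" D] P(1) by metis
    show ?thesis using Q P(2) by (intro exI[of _ Q]) auto
  qed
  have "\<forall>i j. \<exists>Q. i < t \<longrightarrow> degree Q \<le> \<alpha> * D \<and>
       (\<forall>x. x \<notin> Z \<longrightarrow> cell Z x = j \<longrightarrow> q i (?v x) = poly Q x)"
    using restrict q by metis
  then obtain Q where Q: "\<And>i j. i < t \<Longrightarrow> degree (Q i j) \<le> \<alpha> * D"
    "\<And>i x. i < t \<Longrightarrow> x \<notin> Z \<Longrightarrow> q i (?v x) = poly (Q i (cell Z x)) x"
    by metis
  have "\<forall>c j. \<exists>S. c < M \<longrightarrow> degree S \<le> \<beta> * D \<and>
       (\<forall>x. x \<notin> Z \<longrightarrow> cell Z x = j \<longrightarrow> p c (?v x) = poly S x)"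
    using restrict p by metis
  then obtain S where S: "\<And>c j. c < M \<Longrightarrow> degree (S c j) \<le> \<beta> * D"
    "\<And>c x. c < M \<Longrightarrow> x \<notin> Z \<Longrightarrow> p c (?v x) = poly (S c (cell Z x)) x"
    by metis
  \<comment> \<open>A sign condition that vanishes identically on a cell never changes sign there,
    so it contributes no breakpoint and the root set stays finite.\<close>
  define rts where "rts i j = (if Q i j = 0 then {} else {z. poly (Q i j) z = 0})" for i j
  have rts: "finite (rts i j)" "i < t \<Longrightarrow> card (rts i j) \<le> \<alpha> * D" for i j
    using poly_roots_finite[of "Q i j"] card_poly_roots_bound[of "Q i j"] Q(1)[of i j]
    by (auto simp: rts_def)
  \<comment> \<open>Cell numbers run from 0 to \<open>card Z\<close>. Roots of the polynomial of
    cell \<open>j\<close> are kept even if they lie outside that cell, which only refines the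
    partition.\<close>
  define R where "R = (\<Union>j\<le>card Z. \<Union>i<t. rts i j)"
  have "finite R" using rts by (auto simp: R_def)
  moreover have "card R \<le> (card Z + 1) * (t * (\<alpha> * D))"
  proof -
    have "card R \<le> (\<Sum>j\<le>card Z. card (\<Union>i<t. rts i j))"
      unfolding R_def by (rule card_UN_le) simp
    also have "\<dots> \<le> (\<Sum>j\<le>card Z. \<Sum>i<t. card (rts i j))"
      by (intro sum_mono card_UN_le) simp
    also have "\<dots> \<le> (\<Sum>j\<le>card Z. \<Sum>i<t. \<alpha> * D)"
      using rts by (intro sum_mono) auto
    finally show ?thesis by simp
  qed
  moreover have "piecewise_poly (\<beta> * D) Z' (\<lambda>x. \<gamma> (?v x))"
    if Z': "finite Z'" "Z \<union> R \<subseteq> Z'" for Z'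
    unfolding piecewise_poly_def
  proof
    fix j'
    \<comment> \<open>A cell number attained by some point outside \<open>Z'\<close> gets the
      polynomial obtained by freezing all indicators at a sample point \<open>x0\<close>; any other
      number gets the zero polynomial.\<close>
    show "\<exists>T. degree T \<le> \<beta> * D \<and> (\<forall>x. x \<notin> Z' \<longrightarrow> cell Z' x = j' \<longrightarrow> \<gamma> (?v x) = poly T x)"
    proof (cases "\<exists>x0. x0 \<notin> Z' \<and> cell Z' x0 = j'")
      case True
      then obtain x0 where x0: "x0 \<notin> Z'" "cell Z' x0 = j'" by blast
      define j where "j = cell Z x0"
      define T where "T = (\<Sum>c<M. smult ((\<Prod>i\<in>L c. if q i (?v x0) < 0 then 1 else 0)
           * (\<Prod>i\<in>U c. if q i (?v x0) \<ge> 0 then 1 else 0)) (S c j))"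
      have "degree T \<le> \<beta> * D" unfolding T_def
        using S(1) by (intro degree_sum_le) (auto intro: order_trans[OF degree_smult_le])
      moreover have "\<gamma> (?v x) = poly T x" if x: "x \<notin> Z'" "cell Z' x = j'" for x
      proof -
        have xj: "cell Z x = j" "x \<notin> Z" "x0 \<notin> Z"
          using cell_eq_subset[of Z' Z x x0] Z' x x0 by (auto simp: j_def)
        have sgn: "q i (?v x) < 0 \<longleftrightarrow> q i (?v x0) < 0" if "i < t" for i
        proof -
          have "poly (Q i j) x < 0 \<longleftrightarrow> poly (Q i j) x0 < 0"
          proof (rule poly_sign_eq_if_cell_eq)
            assume "Q i j \<noteq> 0"
            then have "{z. poly (Q i j) z = 0} = rts i j" by (simp add: rts_def)
            moreover have "j \<le> card Z" using cell_le_card[OF Z] by (simp add: j_def)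
            ultimately show "{z. poly (Q i j) z = 0} \<subseteq> Z'"
              using Z'(2) that unfolding R_def by blast
          qed (use Z' x x0 in auto)
          then show ?thesis using Q(2) that xj j_def by simp
        qed
        have "(\<Prod>i\<in>L c. if q i (?v x) < 0 then 1 else 0 :: real)
             = (\<Prod>i\<in>L c. if q i (?v x0) < 0 then 1 else 0)"
          "(\<Prod>i\<in>U c. if q i (?v x) \<ge> 0 then 1 else 0 :: real)
             = (\<Prod>i\<in>U c. if q i (?v x0) \<ge> 0 then 1 else 0)" if "c < M" for c
          using UL[OF that] sgn by (auto intro!: prod_indicator_cong simp: not_less[symmetric] subset_iff)
        then show ?thesis
          using S(2) xj by (simp add: \<gamma>_eq T_def poly_sum mult_ac)
      qed
      ultimately show ?thesis by blast
    next
      case False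
      then show ?thesis by (intro exI[of _ 0]) auto
    qed
  qed
  ultimately show ?thesis by blast
qed

text \<open>The one property through which both competing classes enter the lower bound. Crossings
  are counted by an exceptional set because the functions may jump over the level 1/2 without
  attaining it.\<close>

definition crossings_le :: "nat \<Rightarrow> (real \<Rightarrow> real) \<Rightarrow> bool" where
  "crossings_le C \<phi> \<longleftrightarrow> (\<exists>Z. finite Z \<and> card Z \<le> C \<and>
     (\<forall>a b. a \<le> b \<longrightarrow> {a..b} \<inter> Z = {} \<longrightarrow> (\<phi> a < 1/2 \<longleftrightarrow> \<phi> b < 1/2)))"

text \<open>To the breakpoints are added the at most \<open>D\<close> roots of
  \<open>P j - 1/2\<close> for each of the \<open>card Z + 1\<close> cells, and
  \<open>card Z + (card Z + 1) * D\<close> is one less than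
  \<open>(card Z + 1) * (1 + D)\<close>.\<close>

lemma piecewise_poly_crossings:
  assumes Z: "finite Z" and \<phi>: "piecewise_poly D Z \<phi>"
    and C: "(card Z + 1) * (1 + D) \<le> C + 1"
  shows "crossings_le C \<phi>"
proof -
  obtain P where P: "\<And>j. degree (P j) \<le> D" "\<And>x. x \<notin> Z \<Longrightarrow> \<phi> x = poly (P (cell Z x)) x"
    using \<phi> unfolding piecewise_poly_def by metis
  define Q where "Q j = P j - [:1/2:]" for j
  have Q: "degree (Q j) \<le> D" for j
    unfolding Q_def using P(1) by (intro degree_diff_le) auto
  define rts where "rts j = (if Q j = 0 then {} else {z. poly (Q j) z = 0})" for j
  have rts: "finite (rts j)" "card (rts j) \<le> D" for j
    using poly_roots_finite[of "Q j"] card_poly_roots_bound[of "Q j"] Q[of j]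
    by (auto simp: rts_def)
  define Z' where "Z' = Z \<union> (\<Union>j\<le>card Z. rts j)"
  have fin: "finite Z'" using Z rts by (auto simp: Z'_def)
  have "card Z' \<le> card Z + card (\<Union>j\<le>card Z. rts j)"
    unfolding Z'_def by (rule card_Un_le)
  also have "card (\<Union>j\<le>card Z. rts j) \<le> (\<Sum>j\<le>card Z. card (rts j))"
    by (rule card_UN_le) simp
  also have "\<dots> \<le> (\<Sum>j\<le>card Z. D)"
    using rts by (intro sum_mono) auto
  finally have card: "card Z' \<le> C" using C by (simp add: algebra_simps)
  have "\<phi> a < 1/2 \<longleftrightarrow> \<phi> b < 1/2" if ab: "a \<le> b" "{a..b} \<inter> Z' = {}" for a b
  proof -
    have nZ: "a \<notin> Z" "b \<notin> Z" and nZ': "a \<notin> Z'" "b \<notin> Z'"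
      using ab by (auto simp: Z'_def)
    define j where "j = cell Z a"
    have j: "cell Z b = j" "j \<le> card Z"
      using cell_eq_if_no_breakpoint[of a b Z] ab cell_le_card[OF Z]
      by (auto simp: Z'_def j_def Int_Un_distrib)
    have "poly (Q j) a < 0 \<longleftrightarrow> poly (Q j) b < 0"
    proof (rule poly_sign_eq_if_cell_eq[OF fin nZ'])
      show "cell Z' a = cell Z' b" using ab by (rule cell_eq_if_no_breakpoint)
      show "{z. poly (Q j) z = 0} \<subseteq> Z'" if "Q j \<noteq> 0"
        using that j by (force simp: Z'_def rts_def)
    qed
    then show ?thesis using P(2) nZ j by (simp add: Q_def j_def)
  qed
  then show ?thesis unfolding crossings_le_def using fin card by blast
qed

section \<open>Crossings of networks and decision trees along a line\<close>

text \<open>The lists of \<open>net_vals\<close> and \<open>net_depths\<close> grow by appending, so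
  an entry does not depend on how many nodes have been evaluated. \<open>node_val\<close> and
  \<open>node_depth\<close> name these entries and satisfy recursions along the graph.\<close>

definition node_val ::
    "(nat \<Rightarrow> ('d::finite + nat) list) \<Rightarrow> (nat \<Rightarrow> real list \<Rightarrow> real) \<Rightarrow> real^'d \<Rightarrow> nat \<Rightarrow> real" where
  "node_val par gate x i = net_vals par gate x (Suc i) ! i"

definition node_depth :: "(nat \<Rightarrow> ('d + nat) list) \<Rightarrow> nat \<Rightarrow> nat" where
  "node_depth par i = net_depths par (Suc i) ! i"

lemma length_net_vals [simp]: "length (net_vals par gate x n) = n"
  by (induction n) (auto simp: Let_def)

lemma length_net_depths [simp]: "length (net_depths par n) = n"
  by (induction n) (auto simp: Let_def)

lemma net_vals_nth: "i < n \<Longrightarrow> net_vals par gate x n ! i = node_val par gate x i"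
proof (induction n)
  case (Suc n)
  then show ?case
    by (cases "i = n") (auto simp: node_val_def Let_def nth_append)
qed simp

lemma net_depths_nth: "i < n \<Longrightarrow> net_depths par n ! i = node_depth par i"
proof (induction n)
  case (Suc n)
  then show ?case
    by (cases "i = n") (auto simp: node_depth_def Let_def nth_append)
qed simp

lemma net_eval_eq: "N \<ge> 1 \<Longrightarrow> net_eval N par gate x = node_val par gate x (N - 1)"
  by (simp add: net_eval_def net_vals_nth)

lemma net_layers_eq: "N \<ge> 1 \<Longrightarrow> net_layers N par = node_depth par (N - 1)"
  by (simp add: net_layers_def net_depths_nth)

lemma wf_net_parents:
  assumes "wf_net N par" "i < N" "Inr i' \<in> set (par i)"
  shows "i' < i"
proof -
  have "\<forall>u\<in>set (par i). case u of Inl j \<Rightarrow> True | Inr i' \<Rightarrow> i' < i"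
    using assms(1,2) unfolding wf_net_def by blast
  from bspec[OF this assms(3)] show ?thesis by simp
qed

lemma node_val_rec:
  assumes "wf_net N par" "i < N"
  shows "node_val par gate x i = gate i (map (case_sum (\<lambda>j. x $ j) (node_val par gate x)) (par i))"
proof -
  have "node_val par gate x i =
      gate i (map (\<lambda>u. case u of Inl j \<Rightarrow> x $ j | Inr i' \<Rightarrow> net_vals par gate x i ! i') (par i))"
    by (simp add: node_val_def Let_def nth_append)
  also have "map (\<lambda>u. case u of Inl j \<Rightarrow> x $ j | Inr i' \<Rightarrow> net_vals par gate x i ! i') (par i)
      = map (case_sum (\<lambda>j. x $ j) (node_val par gate x)) (par i)"
    using wf_net_parents[OF assms] by (intro map_cong) (auto simp: net_vals_nth split: sum.splits)
  finally show ?thesis .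
qed

lemma node_depth_rec:
  assumes "wf_net N par" "i < N"
  shows "node_depth par i =
    Suc (Max (set (0 # map (case_sum (\<lambda>j. 0) (node_depth par)) (par i))))"
proof -
  have "node_depth par i =
      Suc (Max (set (0 # map (\<lambda>u. case u of Inl j \<Rightarrow> 0 | Inr i' \<Rightarrow> net_depths par i ! i') (par i))))"
    by (simp add: node_depth_def Let_def nth_append)
  also have "map (\<lambda>u. case u of Inl j \<Rightarrow> 0 | Inr i' \<Rightarrow> net_depths par i ! i') (par i)
      = map (case_sum (\<lambda>j. 0) (node_depth par)) (par i)"
    using wf_net_parents[OF assms] by (intro map_cong) (auto simp: net_depths_nth split: sum.splits)
  finally show ?thesis .
qed

lemma node_depth_parent:
  assumes "wf_net N par" "i < N" "Inr i' \<in> set (par i)"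
  shows "node_depth par i' < node_depth par i"
proof -
  have "node_depth par i' \<in> set (0 # map (case_sum (\<lambda>j. 0) (node_depth par)) (par i))"
    using assms(3) by force
  then show ?thesis
    unfolding node_depth_rec[OF assms(1,2)]
    by (intro le_imp_less_Suc Max_ge) auto
qed

text \<open>Every node but the last has a successor, and depth strictly increases along edges, so
  following successors to the unique sink bounds every depth by that of the output.\<close>

lemma node_depth_le_layers:
  assumes "wf_net N par" "i < N"
  shows "node_depth par i \<le> net_layers N par"
  using assms(2)
proof (induction "N - i" arbitrary: i rule: less_induct)
  case less
  have N: "N \<ge> 1" using assms by (simp add: wf_net_def)
  show ?case
  proof (cases "i = N - 1")
    case True
    then show ?thesis using net_layers_eq[OF N, of par] by simp
  next
    case False
    then have "i < N - 1" using less.prems by simp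
    then obtain c where c: "c < N" "Inr i \<in> set (par c)"
      using assms(1) unfolding wf_net_def by blast
    have "i < c" using wf_net_parents[OF assms(1) c] .
    then have "node_depth par c \<le> net_layers N par" using less c by simp
    then show ?thesis using node_depth_parent[OF assms(1) c] by simp
  qed
qed

section \<open>Networks restricted to a line\<close>

lemma piecewise_poly_line_coordinate:
  assumes "D \<ge> 1"
  shows "piecewise_poly D Z (\<lambda>z. (x + z *\<^sub>R e) $ j)"
  unfolding piecewise_poly_def
  by (intro allI exI[of _ "[:x $ j, e $ j:]"]) (use assms in auto)

text \<open>Induction on the depth \<open>l\<close>. Passing to the next layer, each of at most
  \<open>N\<close> gates adds at most \<open>(card Z + 1) * (t * (\<alpha> * \<beta> ^ l))\<close>
  points, which multiplies \<open>card Z + 1\<close> by the next factor of the product and the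
  degree by \<open>\<beta>\<close>.\<close>

lemma net_breakpoints:
  assumes wf: "wf_net N par" and \<beta>: "\<beta> \<ge> 1"
    and gate: "\<And>i. i < N \<Longrightarrow> semialg (length (par i)) t \<alpha> \<beta> (gate i)"
  shows "\<exists>Z. finite Z \<and> card Z + 1 \<le> (\<Prod>i<l. 1 + N * (t * (\<alpha> * \<beta> ^ i))) \<and>
    (\<forall>i<N. node_depth par i \<le> l \<longrightarrow>
       piecewise_poly (\<beta> ^ l) Z (\<lambda>z. node_val par gate (x + z *\<^sub>R e) i))"
proof (induction l)
  case 0
  \<comment> \<open>Internal nodes have depth at least 1, so the base case is vacuous and needs no
    breakpoints.\<close>
  have pos: "node_depth par i \<noteq> 0" if "i < N" for i
    by (subst node_depth_rec[OF wf that]) simp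
  show ?case by (intro exI[of _ "{}"]) (auto dest: pos)
next
  case (Suc l)
  then obtain Z where Z: "finite Z" "card Z + 1 \<le> (\<Prod>i<l. 1 + N * (t * (\<alpha> * \<beta> ^ i)))"
    and pp: "\<And>i. i < N \<Longrightarrow> node_depth par i \<le> l \<Longrightarrow>
       piecewise_poly (\<beta> ^ l) Z (\<lambda>z. node_val par gate (x + z *\<^sub>R e) i)"
    by blast
  \<comment> \<open>Shallower nodes are treated again together with those of depth
    \<open>Suc l\<close>; this gives all of them the same degree bound over the same set
    \<open>Z'\<close>.\<close>
  define I where "I = {i. i < N \<and> node_depth par i \<le> Suc l}"
  define \<Phi> where "\<Phi> i = map (\<lambda>u z. case_sum (\<lambda>j. (x + z *\<^sub>R e) $ j)
     (node_val par gate (x + z *\<^sub>R e)) u) (par i)" for i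
  have "\<forall>i\<in>I. \<exists>R. finite R \<and> card R \<le> (card Z + 1) * (t * (\<alpha> * \<beta> ^ l)) \<and>
           (\<forall>Z'. finite Z' \<longrightarrow> Z \<union> R \<subseteq> Z' \<longrightarrow>
              piecewise_poly (\<beta> * \<beta> ^ l) Z' (\<lambda>z. gate i (map (\<lambda>\<psi>. \<psi> z) (\<Phi> i))))"
  proof (intro ballI semialg_breakpoints[OF Z(1)])
    fix i assume i: "i \<in> I"
    then show "semialg (length (\<Phi> i)) t \<alpha> \<beta> (gate i)" using gate by (simp add: I_def \<Phi>_def)
    fix \<psi> assume "\<psi> \<in> set (\<Phi> i)"
    then obtain u where u: "u \<in> set (par i)"
      "\<psi> = (\<lambda>z. case_sum (\<lambda>j. (x + z *\<^sub>R e) $ j) (node_val par gate (x + z *\<^sub>R e)) u)"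
      by (auto simp: \<Phi>_def)
    show "piecewise_poly (\<beta> ^ l) Z \<psi>"
    proof (cases u)
      case (Inl j)
      then show ?thesis using u \<beta> piecewise_poly_line_coordinate[of "\<beta> ^ l"] by simp
    next
      case (Inr i')
      then have "i' < i" using u wf_net_parents[OF wf, of i i'] i by (simp add: I_def)
      moreover have "node_depth par i' \<le> l"
        using node_depth_parent[OF wf, of i i'] u Inr i by (simp add: I_def)
      ultimately show ?thesis using pp[of i'] i u Inr by (simp add: I_def)
    qed
  qed
  then obtain R where R: "\<And>i. i \<in> I \<Longrightarrow> finite (R i)"
    "\<And>i. i \<in> I \<Longrightarrow> card (R i) \<le> (card Z + 1) * (t * (\<alpha> * \<beta> ^ l))"
    "\<And>i Z'. i \<in> I \<Longrightarrow> finite Z' \<Longrightarrow> Z \<union> R i \<subseteq> Z' \<Longrightarrow>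
       piecewise_poly (\<beta> * \<beta> ^ l) Z' (\<lambda>z. gate i (map (\<lambda>\<psi>. \<psi> z) (\<Phi> i)))"
    by metis
  define Z' where "Z' = Z \<union> (\<Union>i\<in>I. R i)"
  have I: "finite I" "card I \<le> N"
    using card_mono[of "{..<N}" I] by (auto simp: I_def)
  have fin: "finite Z'" using Z R I by (auto simp: Z'_def)
  have "card Z' \<le> card Z + card (\<Union>i\<in>I. R i)"
    unfolding Z'_def by (rule card_Un_le)
  also have "card (\<Union>i\<in>I. R i) \<le> (\<Sum>i\<in>I. card (R i))"
    using I by (intro card_UN_le)
  also have "\<dots> \<le> (\<Sum>i\<in>I. (card Z + 1) * (t * (\<alpha> * \<beta> ^ l)))"
    using R by (intro sum_mono) auto
  also have "\<dots> = card I * ((card Z + 1) * (t * (\<alpha> * \<beta> ^ l)))" by simp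
  also have "\<dots> \<le> N * ((card Z + 1) * (t * (\<alpha> * \<beta> ^ l)))"
    using I by (intro mult_right_mono) auto
  finally have "card Z' + 1 \<le> (card Z + 1) * (1 + N * (t * (\<alpha> * \<beta> ^ l)))"
    by (simp add: algebra_simps)
  also have "\<dots> \<le> (\<Prod>i<l. 1 + N * (t * (\<alpha> * \<beta> ^ i))) * (1 + N * (t * (\<alpha> * \<beta> ^ l)))"
    using Z(2) by (rule mult_right_mono) simp
  finally have card: "card Z' + 1 \<le> (\<Prod>i<Suc l. 1 + N * (t * (\<alpha> * \<beta> ^ i)))"
    by simp
  have "piecewise_poly (\<beta> ^ Suc l) Z' (\<lambda>z. node_val par gate (x + z *\<^sub>R e) i)"
    if i: "i < N" "node_depth par i \<le> Suc l" for i
  proof -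
    have "piecewise_poly (\<beta> * \<beta> ^ l) Z' (\<lambda>z. gate i (map (\<lambda>\<psi>. \<psi> z) (\<Phi> i)))"
      using i fin by (intro R) (auto simp: I_def Z'_def)
    then show ?thesis
      by (simp add: node_val_rec[OF wf i(1)] \<Phi>_def o_def
          del: vector_add_component vector_scaleR_component)
  qed
  then show ?case using fin card by blast
qed

text \<open>Applied with \<open>m = N * t * \<alpha>\<close>. The final degree
  \<open>\<beta> ^ k\<close> is spread over the layers, one \<open>\<beta>\<close> each, so that the
  hypothesis on \<open>m * \<beta>\<close> bounds every factor by
  \<open>2 ^ (1 + k + k * i)\<close>; the exponents sum to about \<open>k ^ 3 / 2\<close>.\<close>

lemma breakpoint_count_le:
  fixes m \<beta> k :: nat
  assumes "m \<ge> 1" "\<beta> \<ge> 1" "m * \<beta> \<le> 2 ^ k" "k \<ge> 1"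
  shows "(\<Prod>i<k. 1 + m * \<beta> ^ i) * (1 + \<beta> ^ k) \<le> 2 ^ (k ^ 3 + 2)"
proof -
  have "1 * \<beta> \<le> m * \<beta>" using assms(1) by (rule mult_right_mono) simp
  then have \<beta>: "\<beta> \<le> 2 ^ k" using assms(3) by linarith
  have "(1 + m * \<beta> ^ i) * \<beta> \<le> 2 ^ (1 + k + k * i)" for i
  proof -
    have "1 \<le> m * \<beta> ^ i" using assms by simp
    then have "(1 + m * \<beta> ^ i) * \<beta> \<le> (2 * (m * \<beta> ^ i)) * \<beta>" by (intro mult_right_mono) auto
    also have "\<dots> = 2 * (m * \<beta>) * \<beta> ^ i" by simp
    also have "\<dots> \<le> 2 * 2 ^ k * (2 ^ k) ^ i"
      using assms(3) \<beta> by (intro mult_mono power_mono) auto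
    finally show ?thesis by (simp add: power_add power_mult)
  qed
  then have "(\<Prod>i<k. (1 + m * \<beta> ^ i) * \<beta>) \<le> (\<Prod>i<k. 2 ^ (1 + k + k * i))"
    by (intro prod_mono) auto
  also have "\<dots> = 2 ^ (\<Sum>i<k. 1 + k + k * i)" by (rule power_sum[symmetric])
  finally have P: "(\<Prod>i<k. 1 + m * \<beta> ^ i) * \<beta> ^ k \<le> 2 ^ (\<Sum>i<k. 1 + k + k * i)"
    by (simp only: prod.distrib prod_constant card_lessThan)
  have "(\<Prod>i<k. 1 + m * \<beta> ^ i) * (1 + \<beta> ^ k) \<le> (\<Prod>i<k. 1 + m * \<beta> ^ i) * (2 * \<beta> ^ k)"
    using assms(2) by (intro mult_left_mono) auto
  also have "\<dots> \<le> 2 ^ (1 + (\<Sum>i<k. 1 + k + k * i))" using P by simp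
  also have "\<dots> \<le> 2 ^ (k ^ 3 + 2)"
  proof (rule power_increasing)
    \<comment> \<open>Arithmetic series, doubled and with \<open>k * n\<close> moved to the left to
      avoid division and subtraction on naturals. The range \<open>n\<close> is separated from
      \<open>k\<close> for the induction and then set to \<open>k\<close>.\<close>
    have "2 * (\<Sum>i<n. 1 + k + k * i) + k * n = 2 * n + 2 * (k * n) + k * (n * n)" for n
      by (induction n) (auto simp: algebra_simps)
    from this[of k] have "2 * (\<Sum>i<k. 1 + k + k * i) = 2 * k + k\<^sup>2 + k ^ 3"
      by (simp add: power2_eq_square power3_eq_cube)
    moreover have "2 * k + k\<^sup>2 \<le> k ^ 3 + 2"
    \<comment> \<open>Equality holds at \<open>k = 1\<close>, so this case cannot be absorbed into a
      cruder estimate.\<close>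
    proof (cases "k = 1")
      case False
      then obtain n where n: "k = n + 2" using assms(4)
        by (metis One_nat_def Suc_1 add.commute le_SucE le_add_diff_inverse not_less_eq_eq)
      show ?thesis unfolding n by (simp add: power2_eq_square power3_eq_cube algebra_simps)
    qed simp
    ultimately show "1 + (\<Sum>i<k. 1 + k + k * i) \<le> k ^ 3 + 2" by linarith
  qed simp
  finally show ?thesis .
qed

lemma semialg_net_crossings:
  assumes "g \<in> semialg_net_fns k (2 ^ k / (real t * real \<alpha> * real \<beta>)) t \<alpha> \<beta>"
    and "k \<ge> 1" "t \<ge> 1" "\<alpha> \<ge> 1" "\<beta> \<ge> 1"
  shows "crossings_le (2 ^ (k ^ 3 + 2)) (\<lambda>z. g (x + z *\<^sub>R e))"
proof -
  obtain N par gate where wf: "wf_net N par"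
    and N: "real N \<le> 2 ^ k / (real t * real \<alpha> * real \<beta>)" and layers: "net_layers N par \<le> k"
    and gate: "\<And>i. i < N \<Longrightarrow> semialg (length (par i)) t \<alpha> \<beta> (gate i)"
    and g: "g = net_eval N par gate"
    using assms(1) unfolding semialg_net_fns_def by blast
  have N1: "N \<ge> 1" using wf by (simp add: wf_net_def)
  obtain Z where Z: "finite Z" "card Z + 1 \<le> (\<Prod>i<k. 1 + N * (t * (\<alpha> * \<beta> ^ i)))"
    and pp: "\<And>i. i < N \<Longrightarrow> node_depth par i \<le> k \<Longrightarrow>
       piecewise_poly (\<beta> ^ k) Z (\<lambda>z. node_val par gate (x + z *\<^sub>R e) i)"
    using net_breakpoints[OF wf \<open>\<beta> \<ge> 1\<close> gate, of k x e] by blast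
  have "real (N * t * \<alpha> * \<beta>) \<le> real (2 ^ k)"
    using N assms by (simp add: field_simps)
  then have "N * t * \<alpha> * \<beta> \<le> 2 ^ k" by (simp only: of_nat_le_iff)
  then have "(\<Prod>i<k. 1 + N * t * \<alpha> * \<beta> ^ i) * (1 + \<beta> ^ k) \<le> 2 ^ (k ^ 3 + 2)"
    using assms N1 by (intro breakpoint_count_le) auto
  moreover have "(card Z + 1) * (1 + \<beta> ^ k) \<le> (\<Prod>i<k. 1 + N * t * \<alpha> * \<beta> ^ i) * (1 + \<beta> ^ k)"
    using Z(2) by (intro mult_right_mono) (auto simp: mult_ac)
  ultimately have "(card Z + 1) * (1 + \<beta> ^ k) \<le> 2 ^ (k ^ 3 + 2) + 1" by linarith
  moreover have "piecewise_poly (\<beta> ^ k) Z (\<lambda>z. g (x + z *\<^sub>R e))"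
    using pp[of "N - 1"] N1 layers by (simp add: g net_eval_eq net_layers_eq)
  ultimately show ?thesis using Z(1) piecewise_poly_crossings by blast
qed

section \<open>Decision trees restricted to a line\<close>

text \<open>Along a line each threshold test is affine in the parameter and switches at most once,
  so every inner node contributes one breakpoint.\<close>

lemma dtree_breakpoints:
  "\<exists>Z. finite Z \<and> card Z \<le> dt_nodes T \<and>
     (\<forall>a b. a \<le> b \<longrightarrow> {a..b} \<inter> Z = {} \<longrightarrow> dt_eval T (x + a *\<^sub>R e) = dt_eval T (x + b *\<^sub>R e))"
proof (induction T)
  case (DLeaf c)
  then show ?case by (intro exI[of _ "{}"]) auto
next
  case (DNode w c l r)
  then obtain Zl Zr where Zl: "finite Zl" "card Zl \<le> dt_nodes l"
      "\<And>a b. a \<le> b \<Longrightarrow> {a..b} \<inter> Zl = {} \<Longrightarrow> dt_eval l (x + a *\<^sub>R e) = dt_eval l (x + b *\<^sub>R e)"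
    and Zr: "finite Zr" "card Zr \<le> dt_nodes r"
      "\<And>a b. a \<le> b \<Longrightarrow> {a..b} \<inter> Zr = {} \<Longrightarrow> dt_eval r (x + a *\<^sub>R e) = dt_eval r (x + b *\<^sub>R e)"
    by blast
  \<comment> \<open>If \<open>w \<bullet> e = 0\<close>, the test is constant along the line and
    division by zero makes \<open>z = 0\<close>, a harmless extra breakpoint.\<close>
  define z where "z = (c - w \<bullet> x) / (w \<bullet> e)"
  have "card (insert z (Zl \<union> Zr)) \<le> 1 + dt_nodes l + dt_nodes r"
    using Zl Zr card_Un_le[of Zl Zr] card_insert_le_m1 by (simp add: card_insert_if)
  moreover have "dt_eval (DNode w c l r) (x + a *\<^sub>R e) = dt_eval (DNode w c l r) (x + b *\<^sub>R e)"
    if ab: "a \<le> b" "{a..b} \<inter> insert z (Zl \<union> Zr) = {}" for a b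
  proof -
    have "z < a \<or> b < z" using ab by auto
    then have "w \<bullet> (x + a *\<^sub>R e) - c \<ge> 0 \<longleftrightarrow> w \<bullet> (x + b *\<^sub>R e) - c \<ge> 0"
    proof (cases "w \<bullet> e = 0")
      case False
      then have "w \<bullet> (x + y *\<^sub>R e) - c = (y - z) * (w \<bullet> e)" for y
        by (simp add: z_def inner_add_right field_simps)
      then show ?thesis using \<open>z < a \<or> b < z\<close> ab(1) False by (auto simp: zero_le_mult_iff)
    qed (simp add: inner_add_right)
    then show ?thesis using Zl(3)[of a b] Zr(3)[of a b] ab by auto
  qed
  ultimately show ?case
    using Zl(1) Zr(1) by (intro exI[of _ "insert z (Zl \<union> Zr)"]) auto
qed

text \<open>The union of the breakpoints of at most \<open>t\<close> trees has at most
  \<open>t * (2 ^ (k ^ 3) / t)\<close> points, and between them the whole combination is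
  constant.\<close>

lemma dtree_comb_crossings:
  assumes "g \<in> dtree_comb_fns t (2 ^ (k ^ 3) / real t)" and "t \<ge> 1"
  shows "crossings_le (2 ^ (k ^ 3 + 2)) (\<lambda>z. g (x + z *\<^sub>R e))"
proof -
  obtain m c T where m: "m \<le> t" and T: "\<And>i. i < m \<Longrightarrow> real (dt_nodes (T i)) \<le> 2 ^ (k ^ 3) / real t"
    and g: "g = (\<lambda>x. \<Sum>i<m. c i * dt_eval (T i) x)"
    using assms(1) unfolding dtree_comb_fns_def by blast
  have "\<forall>i. \<exists>Z. finite Z \<and> card Z \<le> dt_nodes (T i) \<and> (\<forall>a b. a \<le> b \<longrightarrow> {a..b} \<inter> Z = {} \<longrightarrow>
       dt_eval (T i) (x + a *\<^sub>R e) = dt_eval (T i) (x + b *\<^sub>R e))"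
    using dtree_breakpoints by blast
  from choice[OF this] obtain Z where Z: "\<And>i. finite (Z i)" "\<And>i. card (Z i) \<le> dt_nodes (T i)"
    "\<And>i a b. a \<le> b \<Longrightarrow> {a..b} \<inter> Z i = {} \<Longrightarrow>
       dt_eval (T i) (x + a *\<^sub>R e) = dt_eval (T i) (x + b *\<^sub>R e)"
    by blast
  have "card (\<Union>i<m. Z i) \<le> (\<Sum>i<m. card (Z i))" by (rule card_UN_le) simp
  also have "\<dots> \<le> (\<Sum>i<m. dt_nodes (T i))" using Z by (intro sum_mono)
  finally have "real (card (\<Union>i<m. Z i)) \<le> (\<Sum>i<m. real (dt_nodes (T i)))"
    by (metis of_nat_le_iff of_nat_sum)
  also have "\<dots> \<le> (\<Sum>i<m. 2 ^ (k ^ 3) / real t)" using T by (intro sum_mono) auto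
  also have "\<dots> \<le> 2 ^ (k ^ 3 + 2)"
    using m assms(2) by (simp add: field_simps mult_mono)
  finally have "real (card (\<Union>i<m. Z i)) \<le> real (2 ^ (k ^ 3 + 2))" by simp
  then have "card (\<Union>i<m. Z i) \<le> 2 ^ (k ^ 3 + 2)" by (simp only: of_nat_le_iff)
  moreover have "g (x + a *\<^sub>R e) = g (x + b *\<^sub>R e)"
    if "a \<le> b" "{a..b} \<inter> (\<Union>i<m. Z i) = {}" for a b
    unfolding g using that by (intro sum.cong arg_cong2[where f = "(*)"] Z(3)) auto
  ultimately show ?thesis
    unfolding crossings_le_def using Z(1) by (intro exI[of _ "\<Union>i<m. Z i"]) auto
qed

section \<open>The tent map network\<close>

text \<open>The tent map on the unit interval, written as exactly three ReLU gates with weights and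
  biases among 0, 1, 2, -1, -2. The inner \<open>max 0 z\<close> passes \<open>z\<close> through a
  gate so that both summands sit in the same layer.\<close>

definition tent :: "real \<Rightarrow> real" where
  "tent z = max 0 (2 * max 0 z - 2 * max 0 (2 * z - 1))"

lemma tent_eq: "0 \<le> z \<Longrightarrow> z \<le> 1 \<Longrightarrow> tent z = (if z \<le> 1/2 then 2 * z else 2 - 2 * z)"
  by (auto simp: tent_def max_def)

text \<open>The iterate takes the value 0 or 1 at \<open>j / 2 ^ n\<close> according to the parity
  of \<open>j\<close> and has slope of modulus \<open>2 ^ n\<close> in between. The induction peels
  off the innermost tent, which doubles distances and thus turns scale \<open>n + 1\<close> into
  scale \<open>n\<close>.\<close>

lemma tent_iterate_alternates:
  fixes j :: int
  assumes "0 \<le> z" "z \<le> 1" "\<bar>z - of_int j / 2 ^ n\<bar> \<le> 1 / 4 / 2 ^ n"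
  shows "(odd j \<longrightarrow> (tent ^^ n) z \<ge> 3/4) \<and> (even j \<longrightarrow> (tent ^^ n) z \<le> 1/4)"
  using assms
proof (induction n arbitrary: z j)
  case 0
  then have "\<bar>z - of_int j\<bar> \<le> 1/4" by simp
  then have "- 1 < j" "j < 2" using 0 by linarith+
  then have "j = 0 \<or> j = 1" by linarith
  then show ?case using \<open>\<bar>z - of_int j\<bar> \<le> 1/4\<close> by (auto simp: abs_if split: if_splits)
next
  case (Suc n)
  \<comment> \<open>On the right half the tent reflects, so the grid index is reflected too;
    \<open>2 ^ Suc n\<close> is even, hence parity survives.\<close>
  define j' where "j' = (if z \<le> 1/2 then j else 2 ^ Suc n - j)"
  have parity: "even j' \<longleftrightarrow> even j" by (auto simp: j'_def)
  have "\<bar>2 * z - of_int j / 2 ^ n\<bar> = 2 * \<bar>z - of_int j / 2 ^ Suc n\<bar>"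
    by (simp add: abs_if field_simps)
  also have "\<dots> \<le> 1 / 4 / 2 ^ n" using Suc.prems(3) by simp
  finally have close: "\<bar>2 * z - of_int j / 2 ^ n\<bar> \<le> 1 / 4 / 2 ^ n" .
  have "\<bar>tent z - of_int j' / 2 ^ n\<bar> = \<bar>2 * z - of_int j / 2 ^ n\<bar>"
    using tent_eq[OF Suc.prems(1,2)] by (auto simp: j'_def diff_divide_distrib abs_if)
  moreover have "0 \<le> tent z" "tent z \<le> 1" using tent_eq[OF Suc.prems(1,2)] Suc.prems by auto
  ultimately show ?case
    using Suc.IH[of "tent z" j'] close parity
    by (simp add: funpow_Suc_right del: funpow.simps)
qed

section \<open>The ReLU network computing the iterated tent map\<close>

text \<open>Node \<open>3 m + 2\<close> outputs the \<open>m + 1\<close>-st iterate; node 0 also reads the inputs \<open>js\<close>, with weight 0,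
  because a well-formed network must use every input.\<close>

fun tent_parents :: "'d \<Rightarrow> 'd list \<Rightarrow> nat \<Rightarrow> ('d + nat) list" where
  "tent_parents j0 js i =
     (if i mod 3 = 2 then [Inr (i - 2), Inr (i - 1)]
      else if i \<ge> 3 then [Inr (i - i mod 3 - 1)]
      else if i = 0 then Inl j0 # map Inl js else [Inl j0])"

lemma mod3_cases:
  obtains m where "i = 3 * m" | m where "i = 3 * m + 1" | m where "i = 3 * m + (2 :: nat)"
proof -
  have "i = 3 * (i div 3) + i mod 3" by simp
  moreover have "i mod 3 = 0 \<or> i mod 3 = 1 \<or> i mod 3 = 2" by linarith
  ultimately show ?thesis using that by (metis add_0_right)
qed

lemma tent_parents_simps:
  "tent_parents j0 js 0 = Inl j0 # map Inl js"
  "tent_parents j0 js (Suc 0) = [Inl j0]"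
  "tent_parents j0 js (3 * Suc m) = [Inr (3 * m + 2)]"
  "tent_parents j0 js (3 * Suc m + 1) = [Inr (3 * m + 2)]"
  "tent_parents j0 js (3 * m + 2) = [Inr (3 * m), Inr (3 * m + 1)]"
proof -
  have "(3 * m + 2) mod 3 = 2" "(3 * Suc m) mod 3 = 0" "(3 * Suc m + 1) mod 3 = 1"
    by presburger+
  then show "tent_parents j0 js 0 = Inl j0 # map Inl js"
    "tent_parents j0 js (Suc 0) = [Inl j0]"
    "tent_parents j0 js (3 * Suc m) = [Inr (3 * m + 2)]"
    "tent_parents j0 js (3 * Suc m + 1) = [Inr (3 * m + 2)]"
    "tent_parents j0 js (3 * m + 2) = [Inr (3 * m), Inr (3 * m + 1)]"
    by simp_all
qed

lemma tent_parents_less: "Inr i' \<in> set (tent_parents j0 js i) \<Longrightarrow> i' < i"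
  using mod_less_eq_dividend[of i 3] by (auto split: if_splits)

declare tent_parents.simps [simp del]

text \<open>Node 0 reads every input, \<open>3 * m\<close> and \<open>3 * m + 1\<close> feed
  \<open>3 * m + 2\<close>, and that node feeds the next block, so only the last node has no
  successor.\<close>

lemma tent_parents_wf:
  assumes "n \<ge> 1" "insert j0 (set js) = UNIV"
  shows "wf_net (3 * n) (tent_parents j0 js)"
  unfolding wf_net_def
proof (intro conjI allI impI ballI)
  show "1 \<le> 3 * n" using assms by simp
  show "case u of Inl j \<Rightarrow> True | Inr i' \<Rightarrow> i' < i" if "u \<in> set (tent_parents j0 js i)" for i u
    using that by (auto split: sum.split dest: tent_parents_less)
  show "\<exists>i<3 * n. Inl j \<in> set (tent_parents j0 js i)" for j
    using assms by (intro exI[of _ 0]) (auto simp: tent_parents_simps)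
  fix i' assume i': "i' < 3 * n - 1"
  show "\<exists>i<3 * n. Inr i' \<in> set (tent_parents j0 js i)"
  proof (cases i' rule: mod3_cases)
    case (1 m)
    then have "3 * m + 2 < 3 * n" using i' by presburger
    then show ?thesis using 1 tent_parents_simps(5)[of j0 js m] by force
  next
    case (2 m)
    then have "3 * m + 2 < 3 * n" using i' by presburger
    then show ?thesis using 2 tent_parents_simps(5)[of j0 js m] by force
  next
    case (3 m)
    then have "3 * Suc m < 3 * n" using i' by presburger
    then show ?thesis using 3 tent_parents_simps(3)[of j0 js m] by force
  qed
qed

lemma tent_parents_depth:
  assumes "wf_net (3 * n) (tent_parents j0 js)" "m < n"
  shows "node_depth (tent_parents j0 js) (3 * m) = 2 * m + 1 \<and>
    node_depth (tent_parents j0 js) (3 * m + 1) = 2 * m + 1 \<and>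
    node_depth (tent_parents j0 js) (3 * m + 2) = 2 * m + 2"
  using assms(2)
proof (induction m)
  case 0
  have "node_depth (tent_parents j0 js) 0 = 1"
    using 0 by (subst node_depth_rec[OF assms(1)])
      (auto simp: tent_parents_simps image_image image_constant_conv)
  moreover have "node_depth (tent_parents j0 js) 1 = 1"
    using 0 by (subst node_depth_rec[OF assms(1)]) (auto simp: tent_parents_simps)
  ultimately show ?case
    using 0 tent_parents_simps(5)[of j0 js 0]
    by (subst (3) node_depth_rec[OF assms(1)]) auto
next
  case (Suc m)
  then have IH: "node_depth (tent_parents j0 js) (3 * m + 2) = 2 * Suc m" by simp
  have lt: "3 * Suc m < 3 * n" "3 * Suc m + 1 < 3 * n" "3 * Suc m + 2 < 3 * n"
    using Suc.prems by presburger+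
  have "node_depth (tent_parents j0 js) (3 * Suc m) = 2 * Suc m + 1"
    unfolding node_depth_rec[OF assms(1) lt(1)] tent_parents_simps using IH by simp
  moreover have "node_depth (tent_parents j0 js) (3 * Suc m + 1) = 2 * Suc m + 1"
    unfolding node_depth_rec[OF assms(1) lt(2)] tent_parents_simps using IH by simp
  ultimately show ?case
    unfolding node_depth_rec[OF assms(1) lt(3)] tent_parents_simps by simp
qed

lemma relu_net_tent_iterate:
  fixes j0 :: "'d::finite"
  assumes n: "n \<ge> 1" and P: "P \<ge> 5"
  shows "relu_net_fn (2 * n) (3 * n) P (\<lambda>x :: real^'d. (tent ^^ n) (x $ j0))"
proof -
  obtain js where js: "set js = UNIV - {j0}" using finite_list[of "UNIV - {j0}"] by auto
  define par where "par = tent_parents j0 js"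
  define w :: "nat \<Rightarrow> real" where "w = (!) [0, 1, 2, -1, -2]"
  \<comment> \<open>By residue mod 3 the gates are \<open>max 0 z\<close>,
    \<open>max 0 (2 * z - 1)\<close> and \<open>max 0 (2 * a - 2 * b)\<close>. Index 0 holds the
    weight 0 used for the surplus inputs of node 0.\<close>
  define ai :: "nat \<Rightarrow> nat \<Rightarrow> nat" where
    "ai i j = (if i mod 3 = 0 then (if j = 0 then 1 else 0) else if i mod 3 = 1 then 2
       else if j = 0 then 2 else 4)" for i j
  define bi :: "nat \<Rightarrow> nat" where "bi i = (if i mod 3 = 1 then 3 else 0)" for i
  define gate where
    "gate i v = max 0 ((\<Sum>j<length (par i). w (ai i j) * v ! j) + w (bi i))" for i v
  have wf: "wf_net (3 * n) par"
    unfolding par_def using n js by (intro tent_parents_wf) auto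
  have w: "w 0 = 0" "w (Suc 0) = 1" "w 2 = 2" "w 3 = -1" "w 4 = -2"
    by (simp_all add: w_def numeral_eq_Suc)
  have mods: "(3 * m + 2) mod 3 = 2" "(3 * m) mod 3 = 0" "(3 * m + 1) mod 3 = 1" for m :: nat
    by presburger+
  have val: "node_val par gate x (3 * m + 2) = (tent ^^ Suc m) (x $ j0)" if "m < n" for x m
    using that
  proof (induction m)
    case 0
    have "node_val par gate x 0 = max 0 (x $ j0)"
    proof -
      have "(\<Sum>j<length (par 0). w (ai 0 j) * map (case_sum (($) x) (node_val par gate x)) (par 0) ! j)
          = x $ j0"
        by (simp add: par_def tent_parents_simps ai_def w lessThan_Suc_eq_insert_0
            sum.reindex)
      then show ?thesis using 0
        by (subst node_val_rec[OF wf]) (simp_all add: gate_def bi_def w)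
    qed
    moreover have "node_val par gate x 1 = max 0 (2 * x $ j0 - 1)"
      using 0 by (subst node_val_rec[OF wf])
        (simp_all add: gate_def bi_def ai_def w par_def tent_parents_simps)
    ultimately show ?case
      using 0 tent_parents_simps(5)[of j0 js 0]
      by (subst node_val_rec[OF wf])
        (simp_all add: gate_def bi_def ai_def w par_def tent_def lessThan_Suc)
  next
    case (Suc m)
    let ?z = "(tent ^^ Suc m) (x $ j0)"
    have IH: "node_val par gate x (3 * m + 2) = ?z" using Suc by simp
    have lt: "3 * Suc m < 3 * n" "3 * Suc m + 1 < 3 * n" "3 * Suc m + 2 < 3 * n"
      using Suc.prems by presburger+
    have "node_val par gate x (3 * Suc m) = max 0 ?z"
      using IH mods(2)[of "Suc m"] by (subst node_val_rec[OF wf lt(1)])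
        (simp_all add: gate_def bi_def ai_def w par_def tent_parents_simps
           del: mult_Suc_right funpow.simps)
    moreover have "node_val par gate x (3 * Suc m + 1) = max 0 (2 * ?z - 1)"
      using IH mods(3)[of "Suc m"] by (subst node_val_rec[OF wf lt(2)])
        (simp_all add: gate_def bi_def ai_def w par_def tent_parents_simps(4)
           del: mult_Suc_right funpow.simps add_Suc_right One_nat_def)
    ultimately have "node_val par gate x (3 * Suc m + 2) = tent ?z"
      using mods(1)[of "Suc m"] by (subst node_val_rec[OF wf lt(3)])
        (simp_all add: gate_def bi_def ai_def w par_def tent_parents_simps(5) tent_def lessThan_Suc
           del: mult_Suc_right funpow.simps add_2_eq_Suc')
    then show ?case by simp
  qed
  obtain m where m: "n = Suc m" using n by (cases n) auto
  have "(\<lambda>x. (tent ^^ n) (x $ j0)) = net_eval (3 * n) par gate"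
    using val[of m] n m by (auto simp: net_eval_eq)
  then have "(\<lambda>x. (tent ^^ n) (x $ j0)) = net_eval (3 * n) par
      (\<lambda>i v. max 0 ((\<Sum>j<length (par i). w (ai i j) * v ! j) + w (bi i)))"
    by (simp add: gate_def[abs_def])
  moreover have "net_layers (3 * n) par \<le> 2 * n"
    using tent_parents_depth[of n j0 js m] wf n m by (simp add: net_layers_eq par_def)
  moreover have "\<forall>i<3 * n. bi i < P \<and> (\<forall>j<length (par i). ai i j < P)"
    using P by (simp add: ai_def bi_def)
  ultimately show ?thesis
    unfolding relu_net_fn_def using wf by blast
qed

section \<open>The lower bound on the distance\<close>

text \<open>Guarantees integrability over the cube: \<open>integral\<close> is 0 on functions that
  are not integrable, which would ruin a lower bound. Unlike continuity, the property survives the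
  case distinctions of gates and trees.\<close>

definition bounded_measurable :: "(real^'d::finite \<Rightarrow> real) \<Rightarrow> bool" where
  "bounded_measurable h \<longleftrightarrow>
     h \<in> borel_measurable borel \<and> (\<exists>B. \<forall>x\<in>cbox 0 One. \<bar>h x\<bar> \<le> B)"

lemma bounded_measurable_const: "bounded_measurable (\<lambda>x. c)"
  by (auto simp: bounded_measurable_def)

lemma bounded_measurable_continuous:
  assumes "continuous_on UNIV h"
  shows "bounded_measurable h"
proof -
  have "compact (h ` cbox 0 One)"
    using assms by (intro compact_continuous_image) (auto intro: continuous_on_subset)
  then have "bounded (h ` cbox 0 One)" by (rule compact_imp_bounded)
  then obtain B where "\<forall>x\<in>cbox 0 One. \<bar>h x\<bar> \<le> B" unfolding bounded_iff by auto
  moreover have "h \<in> borel_measurable borel"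
    using assms by (rule borel_measurable_continuous_onI)
  ultimately show ?thesis unfolding bounded_measurable_def by blast
qed

lemma bounded_measurable_add:
  assumes "bounded_measurable g" "bounded_measurable h"
  shows "bounded_measurable (\<lambda>x. g x + h x)"
proof -
  obtain A B where "\<forall>x\<in>cbox 0 One. \<bar>g x\<bar> \<le> A" "\<forall>x\<in>cbox 0 One. \<bar>h x\<bar> \<le> B"
    using assms unfolding bounded_measurable_def by blast
  then have "\<forall>x\<in>cbox 0 One. \<bar>g x + h x\<bar> \<le> A + B"
    by (meson abs_triangle_ineq add_mono order_trans)
  then show ?thesis
    using assms unfolding bounded_measurable_def by (auto intro: borel_measurable_add)
qed

lemma bounded_measurable_mult:
  assumes "bounded_measurable g" "bounded_measurable h"
  shows "bounded_measurable (\<lambda>x. g x * h x)"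
proof -
  obtain A B where AB: "\<forall>x\<in>cbox 0 One. \<bar>g x\<bar> \<le> A" "\<forall>x\<in>cbox 0 One. \<bar>h x\<bar> \<le> B"
    using assms unfolding bounded_measurable_def by blast
  have "\<bar>g x * h x\<bar> \<le> A * B" if x: "x \<in> cbox 0 One" for x
    unfolding abs_mult using bspec[OF AB(1) x] bspec[OF AB(2) x] by (intro mult_mono) auto
  then show ?thesis
    using assms unfolding bounded_measurable_def by (auto intro: borel_measurable_times)
qed

lemma bounded_measurable_If:
  assumes "bounded_measurable g" "bounded_measurable h" "Measurable.pred borel P"
  shows "bounded_measurable (\<lambda>x. if P x then g x else h x)"
proof -
  obtain A B where "\<forall>x\<in>cbox 0 One. \<bar>g x\<bar> \<le> A" "\<forall>x\<in>cbox 0 One. \<bar>h x\<bar> \<le> B"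
    using assms unfolding bounded_measurable_def by blast
  then have "\<forall>x\<in>cbox 0 One. \<bar>if P x then g x else h x\<bar> \<le> max A B"
    by (auto simp: max_def intro: order_trans)
  moreover have "(\<lambda>x. if P x then g x else h x) \<in> borel_measurable borel"
  proof -
    have [measurable]: "g \<in> borel_measurable borel" "h \<in> borel_measurable borel"
        "Measurable.pred borel P"
      using assms unfolding bounded_measurable_def by blast+
    show ?thesis by measurable
  qed
  ultimately show ?thesis unfolding bounded_measurable_def by blast
qed

lemma bounded_measurable_sum:
  "(\<And>i. i \<in> I \<Longrightarrow> bounded_measurable (h i)) \<Longrightarrow> bounded_measurable (\<lambda>x. \<Sum>i\<in>I. h i x)"
proof (induction I rule: infinite_finite_induct)
  case (insert i I)
  then show ?case
    using bounded_measurable_add[of "h i" "\<lambda>x. \<Sum>i\<in>I. h i x"] by simp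
qed (simp_all add: bounded_measurable_const)

lemma bounded_measurable_prod:
  "(\<And>i. i \<in> I \<Longrightarrow> bounded_measurable (h i)) \<Longrightarrow> bounded_measurable (\<lambda>x. \<Prod>i\<in>I. h i x)"
proof (induction I rule: infinite_finite_induct)
  case (insert i I)
  then show ?case
    using bounded_measurable_mult[of "h i" "\<lambda>x. \<Prod>i\<in>I. h i x"] by simp
qed (simp_all add: bounded_measurable_const)

lemma bounded_measurable_power: "bounded_measurable h \<Longrightarrow> bounded_measurable (\<lambda>x. h x ^ n)"
  using bounded_measurable_prod[of "{..<n}" "\<lambda>_. h"] by simp

lemma bounded_measurable_poly_fn:
  assumes "poly_fn m a p" "\<And>x. length (v x) = m" "\<And>i. i < m \<Longrightarrow> bounded_measurable (\<lambda>x. v x ! i)"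
  shows "bounded_measurable (\<lambda>x. p (v x))"
proof -
  obtain c where c: "\<And>v. length v = m \<Longrightarrow>
     p v = (\<Sum>e\<in>{e. length e = m \<and> sum_list e \<le> a}. c e * (\<Prod>i<m. (v ! i) ^ (e ! i)))"
    using assms(1) unfolding poly_fn_def by blast
  show ?thesis
    unfolding c[OF assms(2)] using assms(3)
    by (intro bounded_measurable_sum bounded_measurable_mult bounded_measurable_prod
        bounded_measurable_power bounded_measurable_const) auto
qed

lemma bounded_measurable_semialg:
  assumes "semialg m t \<alpha> \<beta> \<gamma>" "\<And>x. length (v x) = m"
    "\<And>i. i < m \<Longrightarrow> bounded_measurable (\<lambda>x. v x ! i)"
  shows "bounded_measurable (\<lambda>x. \<gamma> (v x))"
proof -
  obtain q and M :: nat and U L p where q: "\<forall>i<t. poly_fn m \<alpha> (q i)"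
    and p: "\<forall>j<M. U j \<subseteq> {0..<t} \<and> L j \<subseteq> {0..<t} \<and> poly_fn m \<beta> (p j)"
    and \<gamma>: "\<forall>v. length v = m \<longrightarrow>
           \<gamma> v = (\<Sum>j<M. p j v * (\<Prod>i\<in>L j. if q i v < 0 then 1 else 0)
                                 * (\<Prod>i\<in>U j. if q i v \<ge> 0 then 1 else 0))"
    using assms(1) unfolding semialg_def by blast
  have UL: "i < t" if "j < M" "i \<in> L j \<union> U j" for i j
    using p that by (meson Un_iff atLeastLessThan_iff subsetD)
  have q': "(\<lambda>x. q i (v x)) \<in> borel_measurable borel" if "i < t" for i
    using bounded_measurable_poly_fn[OF q[rule_format, OF that] assms(2,3)]
    unfolding bounded_measurable_def by blast
  have sgn: "Measurable.pred borel (\<lambda>x. q i (v x) < 0)" "Measurable.pred borel (\<lambda>x. q i (v x) \<ge> 0)"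
    if "i < t" for i
    using q'[OF that] by measurable
  have p': "bounded_measurable (\<lambda>x. p j (v x))" if "j < M" for j
    using p that by (intro bounded_measurable_poly_fn[OF _ assms(2,3)]) blast+
  have eq: "(\<lambda>x. \<gamma> (v x)) = (\<lambda>x. \<Sum>j<M. p j (v x) * (\<Prod>i\<in>L j. if q i (v x) < 0 then 1 else 0)
                                 * (\<Prod>i\<in>U j. if q i (v x) \<ge> 0 then 1 else 0))"
    using \<gamma>[rule_format, OF assms(2)] by simp
  show ?thesis unfolding eq
    by (intro bounded_measurable_sum bounded_measurable_mult bounded_measurable_prod
        bounded_measurable_If bounded_measurable_const p' sgn) (auto intro: UL)
qed

lemma bounded_measurable_semialg_net:
  assumes "g \<in> semialg_net_fns k n t \<alpha> \<beta>"
  shows "bounded_measurable g"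
proof -
  obtain N par gate where wf: "wf_net N par"
    and gate: "\<And>i. i < N \<Longrightarrow> semialg (length (par i)) t \<alpha> \<beta> (gate i)"
    and g: "g = net_eval N par gate"
    using assms unfolding semialg_net_fns_def by blast
  have node: "bounded_measurable (\<lambda>x. node_val par gate x i)" if "i < N" for i
    using that
  proof (induction i rule: less_induct)
    case (less i)
    show ?case
      unfolding node_val_rec[OF wf less.prems]
    proof (rule bounded_measurable_semialg[OF gate[OF less.prems]])
      fix l assume l: "l < length (par i)"
      show "bounded_measurable (\<lambda>x. map (case_sum (($) x) (node_val par gate x)) (par i) ! l)"
      proof (cases "par i ! l")
        case (Inl j)
        then show ?thesis using l
          by (auto intro!: bounded_measurable_continuous continuous_intros)
      next
        case (Inr i')
        then have "i' < i" using wf_net_parents[OF wf less.prems, of i'] nth_mem[OF l] by simp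
        then show ?thesis using l Inr less by simp
      qed
    qed simp
  qed
  have "N \<ge> 1" using wf by (simp add: wf_net_def)
  then have "g = (\<lambda>x. node_val par gate x (N - 1))" by (auto simp: g net_eval_eq)
  then show ?thesis using node[of "N - 1"] \<open>N \<ge> 1\<close> by simp
qed

lemma bounded_measurable_dtree: "bounded_measurable (dt_eval T)"
proof (induction T)
  case (DLeaf c)
  then show ?case using bounded_measurable_const[of c] by (simp add: fun_eq_iff cong: if_cong)
next
  case (DNode a b l r)
  have "dt_eval (DNode a b l r) = (\<lambda>x. if a \<bullet> x - b \<ge> 0 then dt_eval l x else dt_eval r x)"
    by auto
  moreover have "Measurable.pred borel (\<lambda>x. a \<bullet> x - b \<ge> 0)" by measurable
  ultimately show ?case using DNode bounded_measurable_If by metis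
qed

lemma bounded_measurable_dtree_comb:
  "g \<in> dtree_comb_fns t n \<Longrightarrow> bounded_measurable g"
  by (auto simp: dtree_comb_fns_def intro!: bounded_measurable_sum bounded_measurable_mult
      bounded_measurable_const bounded_measurable_dtree)

section \<open>From alternation to the distance in mean\<close>

text \<open>The points are grouped into \<open>P\<close> consecutive pairs. If \<open>\<psi>\<close>
  stays on one side of 1/2 on a pair, it is at least 1/4 away from \<open>\<phi>\<close> at one of
  its two points; at most \<open>C\<close> pairs are lost to breakpoints.\<close>

lemma alternation_sum_lower_bound:
  fixes \<phi> \<psi> :: "real \<Rightarrow> real"
  assumes \<delta>: "\<delta> > 0" and \<psi>: "crossings_le C \<psi>"
    and even: "\<And>i. i < 2 * P \<Longrightarrow> even i \<Longrightarrow> \<phi> (real i * \<delta>) \<ge> 3/4"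
    and odd: "\<And>i. i < 2 * P \<Longrightarrow> odd i \<Longrightarrow> \<phi> (real i * \<delta>) \<le> 1/4"
  shows "(\<Sum>i<2 * P. \<bar>\<phi> (real i * \<delta>) - \<psi> (real i * \<delta>)\<bar>) \<ge> (real P - real C) / 4"
proof -
  obtain Z where Z: "finite Z" "card Z \<le> C"
    "\<And>a b. a \<le> b \<Longrightarrow> {a..b} \<inter> Z = {} \<Longrightarrow> \<psi> a < 1/2 \<longleftrightarrow> \<psi> b < 1/2"
    using \<psi> unfolding crossings_le_def by blast
  define h where "h i = \<bar>\<phi> (real i * \<delta>) - \<psi> (real i * \<delta>)\<bar>" for i
  define B where "B = {i. i < P \<and> {real (2 * i) * \<delta>..real (2 * i + 1) * \<delta>} \<inter> Z \<noteq> {}}"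
  \<comment> \<open>the intervals of distinct pairs are disjoint, so a breakpoint spoils at most one pair\<close>
  have "B \<subseteq> (\<lambda>z. nat \<lfloor>z / (2 * \<delta>)\<rfloor>) ` Z"
  proof
    fix i assume "i \<in> B"
    then obtain z where z: "z \<in> Z" "real (2 * i) * \<delta> \<le> z" "z \<le> real (2 * i + 1) * \<delta>"
      by (auto simp: B_def)
    have "real i \<le> z / (2 * \<delta>)" "z / (2 * \<delta>) < real i + 1"
      using z(2,3) \<delta> by (auto simp: field_simps)
    then have "\<lfloor>z / (2 * \<delta>)\<rfloor> = int i" by (intro floor_unique) auto
    then show "i \<in> (\<lambda>z. nat \<lfloor>z / (2 * \<delta>)\<rfloor>) ` Z" using z(1) by force
  qed
  then have "card B \<le> C" using Z by (meson surj_card_le order_trans)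
  have good: "1/4 \<le> h (2 * i) + h (2 * i + 1)" if i: "i < P" "i \<notin> B" for i
  proof -
    have "\<psi> (real (2 * i) * \<delta>) < 1/2 \<longleftrightarrow> \<psi> (real (2 * i + 1) * \<delta>) < 1/2"
      using i \<delta> by (intro Z(3)) (auto simp: B_def)
    moreover have "\<phi> (real (2 * i) * \<delta>) \<ge> 3/4" "\<phi> (real (2 * i + 1) * \<delta>) \<le> 1/4"
      using even[of "2 * i"] odd[of "2 * i + 1"] i by auto
    ultimately show ?thesis unfolding h_def by linarith
  qed
  have B: "finite B" "B \<subseteq> {..<P}" by (auto simp: B_def)
  have "(real P - real C) / 4 \<le> (real P - real (card B)) / 4" using \<open>card B \<le> C\<close> by simp
  also have "\<dots> = (\<Sum>i\<in>{..<P} - B. 1/4)"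
    using B card_mono[of "{..<P}" B] by (simp add: card_Diff_subset of_nat_diff)
  also have "\<dots> \<le> (\<Sum>i\<in>{..<P} - B. h (2 * i) + h (2 * i + 1))"
    using good by (intro sum_mono) auto
  also have "\<dots> \<le> (\<Sum>i<P. h (2 * i) + h (2 * i + 1))"
    by (intro sum_mono2) (auto simp: h_def)
  also have "\<dots> = (\<Sum>i<2 * P. h i)"
    by (induction P) auto
  finally show ?thesis by (simp add: h_def)
qed

lemma nn_integral_lborel_translate:
  fixes h :: "'a::euclidean_space \<Rightarrow> ennreal"
  assumes "h \<in> borel_measurable borel"
  shows "(\<integral>\<^sup>+ x. h x \<partial>lborel) = (\<integral>\<^sup>+ x. h (c + x) \<partial>lborel)"
proof -
  have "(\<integral>\<^sup>+ x. h x \<partial>lborel) = (\<integral>\<^sup>+ x. h x \<partial>distr lborel borel ((+) c))"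
    by (simp add: lborel_distr_plus)
  also have "\<dots> = (\<integral>\<^sup>+ x. h (c + x) \<partial>lborel)"
    using assms by (intro nn_integral_distr) auto
  finally show ?thesis .
qed

text \<open>Passes to the nonnegative Lebesgue integral, where sums and translations can be handled
  without integrability side conditions.\<close>

lemma integral_unit_cube_eq_nn_integral:
  assumes "bounded_measurable h" "\<And>x. 0 \<le> h x"
  shows "ennreal (integral (cbox 0 One) h) = (\<integral>\<^sup>+ x. ennreal (indicator (cbox 0 One) x * h x) \<partial>lborel)"
proof -
  obtain B where B: "\<forall>x\<in>cbox 0 One. \<bar>h x\<bar> \<le> B" and meas: "h \<in> borel_measurable borel"
    using assms(1) unfolding bounded_measurable_def by blast
  let ?F = "\<lambda>x. indicator (cbox 0 One) x * h x"
  have int: "integrable lborel ?F"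
  proof (rule integrableI_bounded_set[where A = "cbox 0 One" and B = B])
    show "emeasure lborel (cbox 0 One :: (real^'a) set) < \<infinity>"
      by (rule emeasure_lborel_cbox_finite)
  qed (use B meas in \<open>auto simp: indicator_def\<close>)
  have "(?F has_integral integral\<^sup>L lborel ?F) UNIV"
    using int by (rule has_integral_integral_lborel)
  moreover have "?F = (\<lambda>x. if x \<in> cbox 0 One then h x else 0)" by (auto simp: indicator_def)
  ultimately have "(h has_integral integral\<^sup>L lborel ?F) (cbox 0 One)"
    by (simp add: has_integral_restrict_UNIV)
  then have "integral (cbox 0 One) h = integral\<^sup>L lborel ?F" by (rule integral_unique)
  then show ?thesis using nn_integral_eq_integral[OF int] assms(2) by (simp add: indicator_def)
qed

lemma One_component: "(One :: real^'d::finite) $ j = 1"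
  using inner_sum_left_Basis[of "axis j 1" "\<lambda>_. 1"] by (simp add: cart_eq_inner_axis)

text \<open>For \<open>x\<close> in the slab \<open>H\<close>, the points
  \<open>x + (i * \<delta>) *\<^sub>R e\<close> alternate between high and low values of
  \<open>f\<close>, so the errors there sum to at least \<open>c\<close>. Integrating over
  \<open>H\<close>, of volume \<open>\<delta> / 2\<close>, and translating back bounds the integral
  below by \<open>c * \<delta> / 2\<close>, which is at least
  \<open>2 ^ (K + 1) / 4 * (\<delta> / 2) = 1/64\<close>.\<close>

lemma alternating_L1_lower_bound:
  fixes f g :: "real^'d::finite \<Rightarrow> real"
  assumes f: "bounded_measurable f" and g: "bounded_measurable g"
    and f_alt: "\<And>x (j :: int). x \<in> cbox 0 One \<Longrightarrow> \<bar>x $ j0 - of_int j / 2 ^ (K + 4)\<bar> \<le> 1 / 4 / 2 ^ (K + 4)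
       \<Longrightarrow> (odd j \<longrightarrow> f x \<ge> 3/4) \<and> (even j \<longrightarrow> f x \<le> 1/4)"
    and g_cross: "\<And>x. crossings_le (2 ^ (K + 2)) (\<lambda>z. g (x + z *\<^sub>R axis j0 1))"
  shows "integral (cbox 0 One) (\<lambda>x. \<bar>f x - g x\<bar>) \<ge> 1/64"
proof -
  define \<delta> :: real where "\<delta> = 1 / 2 ^ (K + 4)"
  \<comment> \<open>The \<open>2 ^ (K + 4) - 1\<close> multiples of \<open>\<delta>\<close> strictly
    between 0 and 1 form \<open>P\<close> pairs, with the last one left over.\<close>
  define P :: nat where "P = 2 ^ (K + 3) - 1"
  define e :: "real^'d" where "e = axis j0 1"
  define Q :: "(real^'d) set" where "Q = cbox 0 One"
  define h where "h x = \<bar>f x - g x\<bar>" for x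
  define F where "F x = indicator Q x * h x" for x
  \<comment> \<open>The slab is centred at \<open>\<delta>\<close>, the first peak of
    \<open>f\<close>, with half-width \<open>\<delta> / 4\<close>, the tolerance in
    \<open>f_alt\<close>.\<close>
  define H :: "(real^'d) set" where
    "H = cbox (\<chi> j. if j = j0 then 3/4 * \<delta> else 0) (\<chi> j. if j = j0 then 5/4 * \<delta> else 1)"
  define c where "c = (real P - 2 ^ (K + 2)) / 4"
  have \<delta>: "\<delta> > 0" by (simp add: \<delta>_def)
  have P: "real P = 2 ^ (K + 3) - 1" by (simp add: P_def of_nat_diff)
  have P\<delta>: "real (2 * P) * \<delta> = 1 - 2 * \<delta>"
    by (simp add: P \<delta>_def power_add field_simps)
  \<comment> \<open>Here \<open>P - 2 ^ (K + 2) = 2 ^ (K + 2) - 1\<close>, which is at least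
    \<open>2 ^ (K + 1)\<close>.\<close>
  have c: "c \<ge> 2 ^ (K + 1) / 4" unfolding c_def P
    using one_le_power[of "2 :: real" "K + 1"] by (simp add: power_add)
  have Q: "x \<in> Q \<longleftrightarrow> (\<forall>j. 0 \<le> x $ j \<and> x $ j \<le> 1)" for x
    unfolding Q_def mem_box_cart One_component by simp
  have bm_h: "bounded_measurable h"
  proof -
    have "bounded_measurable (\<lambda>x. f x + (- 1) * g x)"
      by (intro bounded_measurable_add bounded_measurable_mult bounded_measurable_const f g)
    then show ?thesis
      unfolding bounded_measurable_def h_def by (auto intro: borel_measurable_abs)
  qed
  then have [measurable]: "h \<in> borel_measurable borel" by (simp add: bounded_measurable_def)
  have [measurable]: "Q \<in> sets borel" "H \<in> sets borel" by (simp_all add: Q_def H_def)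
  have [measurable]: "F \<in> borel_measurable borel" unfolding F_def by measurable
  have F_nonneg: "0 \<le> F x" for x by (simp add: F_def h_def)
  have pointwise: "c \<le> (\<Sum>i<2 * P. F ((real i * \<delta>) *\<^sub>R e + x))" if x: "x \<in> H" for x
  proof -
    have xj: "3/4 * \<delta> \<le> x $ j0" "x $ j0 \<le> 5/4 * \<delta>" "\<And>j. j \<noteq> j0 \<Longrightarrow> 0 \<le> x $ j \<and> x $ j \<le> 1"
      using x by (auto simp: H_def mem_box_cart dest: spec[of _ j0] split: if_splits)
    have coord: "(x + z *\<^sub>R e) $ j = (if j = j0 then x $ j0 + z else x $ j)" for z j
      by (simp add: e_def axis_def)
    have inQ: "x + (real i * \<delta>) *\<^sub>R e \<in> Q" if "i < 2 * P" for i
    proof -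
      have "real i * \<delta> \<le> (real (2 * P) - 1) * \<delta>"
        using that \<delta> by (intro mult_right_mono) auto
      then have "real i * \<delta> + 3 * \<delta> \<le> 1" using P\<delta> by (simp add: algebra_simps)
      moreover have "0 \<le> real i * \<delta>" using \<delta> by simp
      ultimately show ?thesis unfolding Q coord using xj \<delta> by auto
    qed
    have alt: "(even i \<longrightarrow> f (x + (real i * \<delta>) *\<^sub>R e) \<ge> 3/4) \<and>
        (odd i \<longrightarrow> f (x + (real i * \<delta>) *\<^sub>R e) \<le> 1/4)" if "i < 2 * P" for i
    proof -
      \<comment> \<open>The \<open>i\<close>-th translate is centred at
        \<open>(i + 1) * \<delta>\<close>, so even \<open>i\<close> corresponds to an odd grid index
        and hence to a peak.\<close>
      have eq: "of_int (int i + 1) / 2 ^ (K + 4) = real i * \<delta> + \<delta>" "1 / 4 / 2 ^ (K + 4) = \<delta> / 4"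
        by (simp_all add: \<delta>_def add_divide_distrib)
      have "\<bar>(x + (real i * \<delta>) *\<^sub>R e) $ j0 - of_int (int i + 1) / 2 ^ (K + 4)\<bar> \<le> 1 / 4 / 2 ^ (K + 4)"
        unfolding eq coord using xj(1,2) by (auto simp: abs_if)
      from f_alt[OF inQ[OF that, unfolded Q_def] this] show ?thesis by simp
    qed
    have "(real P - real (2 ^ (K + 2))) / 4 \<le>
       (\<Sum>i<2 * P. \<bar>f (x + (real i * \<delta>) *\<^sub>R e) - g (x + (real i * \<delta>) *\<^sub>R e)\<bar>)"
      using alternation_sum_lower_bound[OF \<delta> g_cross[of x], of P "\<lambda>z. f (x + z *\<^sub>R e)"] alt
      unfolding e_def by blast
    also have "\<dots> = (\<Sum>i<2 * P. F ((real i * \<delta>) *\<^sub>R e + x))"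
      using inQ by (intro sum.cong) (auto simp: F_def h_def add.commute)
    finally show ?thesis by (simp add: c_def)
  qed
  \<comment> \<open>The translates have thickness \<open>\<delta> / 2\<close> and spacing
    \<open>\<delta>\<close>, so each point lies in at most one.\<close>
  have disjoint: "(\<Sum>i<2 * P. indicator H (x - (real i * \<delta>) *\<^sub>R e)) \<le> (1 :: ennreal)" for x
  proof (cases "\<exists>i<2 * P. x - (real i * \<delta>) *\<^sub>R e \<in> H")
    case True
    then obtain i where i: "i < 2 * P" "x - (real i * \<delta>) *\<^sub>R e \<in> H" by blast
    have range: "3/4 * \<delta> \<le> x $ j0 - real k * \<delta> \<and> x $ j0 - real k * \<delta> \<le> 5/4 * \<delta>"
      if "x - (real k * \<delta>) *\<^sub>R e \<in> H" for k
    proof -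
      have "3/4 * \<delta> \<le> (x - (real k * \<delta>) *\<^sub>R e) $ j0 \<and> (x - (real k * \<delta>) *\<^sub>R e) $ j0 \<le> 5/4 * \<delta>"
        using that unfolding H_def mem_box_cart by (auto dest: spec[of _ j0])
      then show ?thesis by (simp add: e_def)
    qed
    have uniq: "k = i" if "x - (real k * \<delta>) *\<^sub>R e \<in> H" for k
    proof -
      have "real k * \<delta> < (real i + 1) * \<delta>" "real i * \<delta> < (real k + 1) * \<delta>"
        using range[OF that] range[OF i(2)] \<delta> by (auto simp: algebra_simps)
      then have "real k < real i + 1" "real i < real k + 1" using \<delta> by simp_all
      then show ?thesis by linarith
    qed
    have "indicator H (x - (real k * \<delta>) *\<^sub>R e) = (if k = i then 1 else 0 :: ennreal)" for k
      using uniq[of k] i(2) by (cases "k = i") (auto simp: indicator_def)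
    then show ?thesis using i by simp
  qed (auto simp: indicator_def)
  have meas: "(\<lambda>x. indicator H (x - a) * ennreal (F x)) \<in> borel_measurable borel" for a
  proof -
    have "(\<lambda>x. x - a) \<in> borel \<rightarrow>\<^sub>M borel" by measurable
    moreover have "(indicator H :: _ \<Rightarrow> ennreal) \<in> borel_measurable borel" by measurable
    ultimately have "(\<lambda>x. indicator H (x - a) :: ennreal) \<in> borel_measurable borel"
      by (rule measurable_compose)
    moreover have "(\<lambda>x. ennreal (F x)) \<in> borel_measurable borel" by measurable
    ultimately show ?thesis by (rule borel_measurable_times_ennreal)
  qed
  have "ennreal (c * (\<delta> / 2)) = ennreal c * emeasure lborel H"
  proof -
    have "cbox (\<chi> j. if j = j0 then 3/4 * \<delta> else 0) (\<chi> j. if j = j0 then 5/4 * \<delta> else 1) \<noteq> ({} :: (real^'d) set)"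
      using \<delta> by (auto simp: interval_ne_empty_cart)
    from content_cbox_cart[OF this] have "measure lborel H =
        (\<Prod>j\<in>UNIV. (if j = j0 then 5/4 * \<delta> else 1) - (if j = j0 then 3/4 * \<delta> else 0))"
      by (simp add: H_def)
    also have "\<dots> = (\<Prod>j\<in>UNIV. if j = j0 then \<delta> / 2 else 1)" by (intro prod.cong) auto
    finally have "measure lborel H = \<delta> / 2" by simp
    then have "emeasure lborel H = ennreal (\<delta> / 2)"
      using emeasure_lborel_cbox_finite unfolding H_def
      by (metis emeasure_eq_ennreal_measure less_irrefl infinity_ennreal_def)
    moreover have "0 \<le> c" using c by (rule order_trans[rotated]) simp
    ultimately show ?thesis using \<delta> ennreal_mult[of c "\<delta> / 2"] by simp
  qed
  also have "\<dots> = (\<integral>\<^sup>+ x. ennreal c * indicator H x \<partial>lborel)"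
    by (subst nn_integral_cmult_indicator) auto
  also have "\<dots> \<le> (\<integral>\<^sup>+ x. (\<Sum>i<2 * P. indicator H x * ennreal (F ((real i * \<delta>) *\<^sub>R e + x))) \<partial>lborel)"
  proof (rule nn_integral_mono)
    fix x
    show "ennreal c * indicator H x \<le> (\<Sum>i<2 * P. indicator H x * ennreal (F ((real i * \<delta>) *\<^sub>R e + x)))"
    proof (cases "x \<in> H")
      case True
      then show ?thesis using pointwise[OF True] F_nonneg
        by (simp add: sum_ennreal ennreal_leI)
    qed simp
  qed
  also have "\<dots> = (\<Sum>i<2 * P. \<integral>\<^sup>+ x. indicator H x * ennreal (F ((real i * \<delta>) *\<^sub>R e + x)) \<partial>lborel)"
    by (rule nn_integral_sum) measurable
  \<comment> \<open>Translation invariance moves the shift from the integrand to the slab; the sum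
    then ranges over disjoint slabs and is at most the integral of \<open>F\<close>.\<close>
  also have "\<dots> = (\<Sum>i<2 * P. \<integral>\<^sup>+ x. indicator H (x - (real i * \<delta>) *\<^sub>R e) * ennreal (F x) \<partial>lborel)"
  proof (rule sum.cong[OF refl])
    fix i
    show "(\<integral>\<^sup>+ x. indicator H x * ennreal (F ((real i * \<delta>) *\<^sub>R e + x)) \<partial>lborel) =
        (\<integral>\<^sup>+ x. indicator H (x - (real i * \<delta>) *\<^sub>R e) * ennreal (F x) \<partial>lborel)"
      using nn_integral_lborel_translate[OF meas, of "(real i * \<delta>) *\<^sub>R e" "(real i * \<delta>) *\<^sub>R e"]
      by simp
  qed
  also have "\<dots> = (\<integral>\<^sup>+ x. (\<Sum>i<2 * P. indicator H (x - (real i * \<delta>) *\<^sub>R e) * ennreal (F x)) \<partial>lborel)"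
    using meas by (intro nn_integral_sum[symmetric]) simp
  also have "\<dots> \<le> (\<integral>\<^sup>+ x. ennreal (F x) \<partial>lborel)"
  proof (rule nn_integral_mono)
    fix x
    have "(\<Sum>i<2 * P. indicator H (x - (real i * \<delta>) *\<^sub>R e) * ennreal (F x))
        = (\<Sum>i<2 * P. indicator H (x - (real i * \<delta>) *\<^sub>R e)) * ennreal (F x)"
      by (rule sum_distrib_right[symmetric])
    also have "\<dots> \<le> 1 * ennreal (F x)" by (rule mult_right_mono[OF disjoint]) simp
    finally show "(\<Sum>i<2 * P. indicator H (x - (real i * \<delta>) *\<^sub>R e) * ennreal (F x)) \<le> ennreal (F x)"
      by simp
  qed
  also have "\<dots> = ennreal (integral (cbox 0 One) h)"
    unfolding F_def Q_def
    by (rule integral_unit_cube_eq_nn_integral[symmetric, OF bm_h]) (simp add: h_def)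
  finally have "ennreal (c * (\<delta> / 2)) \<le> ennreal (integral (cbox 0 One) h)" .
  \<comment> \<open>Since \<open>ennreal\<close> truncates negative numbers to 0, nonnegativity is
    required to return to a real inequality.\<close>
  moreover have "0 \<le> integral (cbox 0 One) h"
    by (cases "h integrable_on cbox 0 One") (auto simp: h_def integral_nonneg not_integrable_integral)
  ultimately have "c * (\<delta> / 2) \<le> integral (cbox 0 One) h" by simp
  moreover have "1/64 \<le> c * (\<delta> / 2)"
  proof -
    have "1/64 = 2 ^ (K + 1) / 4 * (\<delta> / 2)" by (simp add: \<delta>_def power_add)
    also have "\<dots> \<le> c * (\<delta> / 2)" using c \<delta> by (intro mult_right_mono) auto
    finally show ?thesis .
  qed
  ultimately have "1/64 \<le> integral (cbox 0 One) h" by linarith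
  then show ?thesis by (simp add: h_def[abs_def])
qed

section \<open>Assembling the separation theorem\<close>

lemma continuous_on_tent_iterate: "continuous_on UNIV (tent ^^ n)"
proof (induction n)
  case (Suc n)
  have "continuous_on A tent" for A
    unfolding tent_def[abs_def] by (intro continuous_intros)
  then show ?case unfolding funpow.simps using Suc by (intro continuous_on_compose)
qed (simp add: id_def)

theorem theorem1p1:
  fixes k t \<alpha> \<beta> :: nat
  assumes "k \<ge> 1" and "t \<ge> 1" and "\<alpha> \<ge> 1" and "\<beta> \<ge> 1"
  shows "\<exists>f :: real^'d \<Rightarrow> real.
           relu_net_fn (2 * k^3 + 8) (3 * k^3 + 12) (4 + CARD('d)) f \<and>
           (INF g \<in> semialg_net_fns k (2 ^ k / (real t * real \<alpha> * real \<beta>)) t \<alpha> \<beta>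
                    \<union> dtree_comb_fns t (2 ^ (k^3) / real t).
              integral (cbox 0 One) (\<lambda>x. \<bar>f x - g x\<bar>)) \<ge> 1 / 64"
proof -
  define j0 :: 'd where "j0 = undefined"
  define f :: "real^'d \<Rightarrow> real" where "f x = (tent ^^ (k ^ 3 + 4)) (x $ j0)" for x
  \<comment> \<open>The five parameters fit because the dimension is at least 1.\<close>
  have "relu_net_fn (2 * (k ^ 3 + 4)) (3 * (k ^ 3 + 4)) (4 + CARD('d)) f"
    unfolding f_def by (rule relu_net_tent_iterate) (simp_all add: Suc_le_eq)
  then have relu: "relu_net_fn (2 * k ^ 3 + 8) (3 * k ^ 3 + 12) (4 + CARD('d)) f" by simp
  have "continuous_on UNIV f"
    unfolding f_def
    by (rule continuous_on_compose2[OF continuous_on_tent_iterate]) (auto intro: continuous_intros)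
  then have f_bm: "bounded_measurable f" by (rule bounded_measurable_continuous)
  have f_alt: "(odd j \<longrightarrow> f x \<ge> 3/4) \<and> (even j \<longrightarrow> f x \<le> 1/4)"
    if "x \<in> cbox 0 One" "\<bar>x $ j0 - of_int j / 2 ^ (k ^ 3 + 4)\<bar> \<le> 1 / 4 / 2 ^ (k ^ 3 + 4)"
    for x and j :: int
  proof -
    have "0 \<le> x $ j0" "x $ j0 \<le> 1"
      using that(1) unfolding mem_box_cart One_component by simp_all
    then show ?thesis unfolding f_def using that(2) by (rule tent_iterate_alternates)
  qed
  let ?C = "semialg_net_fns k (2 ^ k / (real t * real \<alpha> * real \<beta>)) t \<alpha> \<beta>
    \<union> dtree_comb_fns t (2 ^ (k^3) / real t) :: (real^'d \<Rightarrow> real) set"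
  \<comment> \<open>A real infimum is bounded below by \<open>cINF_greatest\<close> only over a
    nonempty set; the empty combination of trees provides an element.\<close>
  have "(\<lambda>x. 0) \<in> dtree_comb_fns t (2 ^ (k^3) / real t)"
    unfolding dtree_comb_fns_def by (intro CollectI exI[of _ 0]) auto
  then have "?C \<noteq> {}" by blast
  moreover have "1/64 \<le> integral (cbox 0 One) (\<lambda>x. \<bar>f x - g x\<bar>)" if "g \<in> ?C" for g
  proof (rule alternating_L1_lower_bound[OF f_bm _ f_alt])
    show "bounded_measurable g"
      using that bounded_measurable_semialg_net bounded_measurable_dtree_comb by blast
    show "crossings_le (2 ^ (k ^ 3 + 2)) (\<lambda>z. g (x + z *\<^sub>R axis j0 1))" for x
      using that semialg_net_crossings dtree_comb_crossings assms by blast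
  qed
  ultimately have "1/64 \<le> (INF g \<in> ?C. integral (cbox 0 One) (\<lambda>x. \<bar>f x - g x\<bar>))"
    by (intro cINF_greatest)
  then show ?thesis using relu by blast
qed

end
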